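(* Let $\rho>0$ and consider the Mallows culture on candidates $\{1,2,3\}$ with reference ranking $(1,2,3)$ and concentration parameter $\rho$, with $n$ independent voters. Let $\boldsymbol\zeta=(e^{-3\rho/2},e^{-\rho/2})$. Then, as $n\to+\infty$, \[ \mathbb{P}(3\text{ is the Condorcet winner})\sim\frac{P(\boldsymbol\zeta)^n}{\prod_{j\in\{1,2\}}\big((1-\zeta_j)\zeta_j^{\lceil n/2\rceil-1}\big)}\cdot\frac{1}{2\pi n\sqrt{\det(\mathcal{H}_K(\boldsymbol\tau))}}, \] where $P(\boldsymbol\zeta)=\dfrac{2e^{-2\rho}(1+e^{-\rho/2}+e^{-\rho})}{(1+e^{-\rho})(1+e^{-\rho}+e^{-2\rho})}$ and $\det(\mathcal{H}_K(\boldsymbol\tau))=\dfrac14\cdot\dfrac{e^{-\rho/2}(1+e^{-\rho})}{(1+e^{-\rho/2}+e^{-\rho})^2}$.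
   Context: Mallows culture with reference ranking $r_0$ and parameter $\rho$: each voter independently draws ranking $r$ with probability $\gamma e^{-\rho d(r,r_0)}$, $d$ the Kendall tau distance (number of discordant pairs), $\gamma$ normalizing. Candidate $3$ is the Condorcet winner if, for each $j\in\{1,2\}$, strictly more than $n/2$ voters rank $3$ above $j$. For $\mathcal{X}\subseteq\{1,2\}$, $p_{\mathcal{X}}$ is the probability that the set of candidates ranked above $3$ is exactly $\mathcal{X}$; $P(x_1,x_2)=\sum_{\mathcal{X}}p_{\mathcal{X}}\prod_{j\in\mathcal{X}}x_j$; $K(\mathbf{t})=\log P(e^{t_1},e^{t_2})$; $\boldsymbol\tau=(-3\rho/2,-\rho/2)=\log\boldsymbol\zeta$ and $\mathcal{H}_K(\boldsymbol\tau)$ is the Hessian of $K$ at $\boldsymbol\tau$. *)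

theory Defs
  imports "HOL-Analysis.Analysis" "HOL-Library.Landau_Symbols" "HOL-Combinatorics.Permutations"
begin

text \<open>Candidates are 1, 2, 3. A ranking is encoded as a permutation sigma of {1,2,3}
  with sigma c = position of candidate c (position 1 = top). The reference ranking
  (1,2,3) is the identity.\<close>

definition rankings :: "(nat \<Rightarrow> nat) set" where
  "rankings = {\<sigma>. \<sigma> permutes {1,2,3::nat}}"

definition above :: "(nat \<Rightarrow> nat) \<Rightarrow> nat \<Rightarrow> nat \<Rightarrow> bool" where
  "above \<sigma> a b \<longleftrightarrow> \<sigma> a < \<sigma> b"

definition kendall_ref :: "(nat \<Rightarrow> nat) \<Rightarrow> nat" where
  "kendall_ref \<sigma> = card {(a,b). a \<in> {1,2,3} \<and> b \<in> {1,2,3} \<and> a < b \<and> above \<sigma> b a}"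

definition mallows :: "real \<Rightarrow> (nat \<Rightarrow> nat) \<Rightarrow> real" where
  "mallows \<rho> \<sigma> = exp (- \<rho> * real (kendall_ref \<sigma>)) /
      (\<Sum>\<tau>\<in>rankings. exp (- \<rho> * real (kendall_ref \<tau>)))"

definition prob_cw3 :: "real \<Rightarrow> nat \<Rightarrow> real" where
  "prob_cw3 \<rho> n =
     (\<Sum>p\<in>(PiE {..<n} (\<lambda>_. rankings)).
        (\<Prod>i<n. mallows \<rho> (p i)) *
        (if (\<forall>j\<in>{1,2::nat}. 2 * card {i\<in>{..<n}. above (p i) 3 j} > n) then 1 else 0))"

definition pX :: "real \<Rightarrow> nat set \<Rightarrow> real" where
  "pX \<rho> X = (\<Sum>\<sigma>\<in>{\<sigma>\<in>rankings. {j\<in>{1,2}. above \<sigma> j 3} = X}. mallows \<rho> \<sigma>)"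

definition Ppoly :: "real \<Rightarrow> (nat \<Rightarrow> real) \<Rightarrow> real" where
  "Ppoly \<rho> x = (\<Sum>X\<in>Pow {1,2}. pX \<rho> X * (\<Prod>j\<in>X. x j))"

definition Kfun :: "real \<Rightarrow> (nat \<Rightarrow> real) \<Rightarrow> real" where
  "Kfun \<rho> t = ln (Ppoly \<rho> (\<lambda>j. exp (t j)))"

definition zeta :: "real \<Rightarrow> nat \<Rightarrow> real" where
  "zeta \<rho> j = (if j = 1 then exp (- 3 * \<rho> / 2) else exp (- \<rho> / 2))"

definition tau :: "real \<Rightarrow> nat \<Rightarrow> real" where
  "tau \<rho> j = ln (zeta \<rho> j)"

definition pderiv_i :: "((nat \<Rightarrow> real) \<Rightarrow> real) \<Rightarrow> nat \<Rightarrow> (nat \<Rightarrow> real) \<Rightarrow> real" where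
  "pderiv_i f i t = deriv (\<lambda>s. f (t(i := s))) (t i)"

definition hessian :: "((nat \<Rightarrow> real) \<Rightarrow> real) \<Rightarrow> nat \<Rightarrow> nat \<Rightarrow> (nat \<Rightarrow> real) \<Rightarrow> real" where
  "hessian f i j t = pderiv_i (\<lambda>u. pderiv_i f j u) i t"

definition det2_hessian :: "((nat \<Rightarrow> real) \<Rightarrow> real) \<Rightarrow> (nat \<Rightarrow> real) \<Rightarrow> real" where
  "det2_hessian f t = hessian f 1 1 t * hessian f 2 2 t - hessian f 1 2 t * hessian f 2 1 t"

end

theory Submission
  imports Defs "HOL-Real_Asymp.Real_Asymp" "HOL-Probability.Characteristic_Functions"
begin

text \<open>
  Exponential tilting by \<zeta> turns the pair (number of voters ranking 1 above 3, number ranking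
  2 above 3) into a sum of n independent steps: with probability 1 - x a voter contributes (0,0)
  or (1,1), each equally likely, and with probability x it contributes (1,0) or (0,1), each
  equally likely, where x = s / (1 + s + s^2) and s = exp (- \<rho> / 2). Given the binomially
  distributed number k of voters of the second kind, the sum of the two counts minus n and their
  difference are therefore independent simple random walks of n - k and k steps. Wallis' product gives the local limit
  of each walk, the law of large numbers replaces k / n by x, and the parity constraint on k
  contributes a factor 1/2, so the tilted point probabilities near the mean are
  asymptotic to 1 / (pi n sqrt (x (1 - x))). Summing them against the geometric weights left
  over from the tilting (by dominated convergence) gives the claim.
\<close>

subsection \<open>Local limit of the simple random walk\<close>

text \<open>Recursion over the last step, instead of a binomial coefficient over a power of 2, lets
  positions range over all integers, so that neither parity nor range needs separate cases.\<close>

fun walk :: "nat \<Rightarrow> int \<Rightarrow> real" where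
  "walk 0 d = of_bool (d = 0)"
| "walk (Suc k) d = (walk k (d - 1) + walk k (d + 1)) / 2"

lemma walk_nonneg: "0 \<le> walk k d"
  by (induction k arbitrary: d) auto

lemma walk_minus: "walk k (- d) = walk k d"
proof (induction k arbitrary: d)
  case (Suc k)
  have "- d - 1 = - (d + 1)" "- d + 1 = - (d - 1)" by simp_all
  then have "walk k (- d - 1) = walk k (d + 1)" "walk k (- d + 1) = walk k (d - 1)"
    by (simp_all only: Suc)
  then show ?case by simp
qed auto

lemma walk_odd: "odd (int k + d) \<Longrightarrow> walk k d = 0"
  by (induction k arbitrary: d) auto

text \<open>In closed form this is the ratio of neighbouring binomial coefficients. In the induction
  both sides for \<open>Suc k\<close> reduce to \<open>(k + 1) * walk k (d + 1)\<close>; free of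
  division, the identity also covers positions where the probability vanishes.\<close>

lemma walk_ratio: "of_int (int k + d + 2) * walk k (d + 2) = of_int (int k - d) * walk k d"
proof (induction k arbitrary: d)
  case (Suc k)
  have 1: "of_int (int k + d + 3) * walk k (d + 3) = of_int (int k - d - 1) * walk k (d + 1)"
    using Suc[of "d + 1"] by (simp add: algebra_simps)
  have 2: "of_int (int k + d + 1) * walk k (d + 1) = of_int (int k - d + 1) * walk k (d - 1)"
    using Suc[of "d - 1"] by (simp add: algebra_simps)
  have "walk (Suc k) (d + 2) = (walk k (d + 1) + walk k (d + 3)) / 2"
    by (simp add: algebra_simps)
  then have "2 * (of_int (int (Suc k) + d + 2) * walk (Suc k) (d + 2)) = 2 * (real k + 1) * walk k (d + 1)"
    using 1 by (simp add: algebra_simps)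
  moreover have "2 * (of_int (int (Suc k) - d) * walk (Suc k) d) = 2 * (real k + 1) * walk k (d + 1)"
    using 2 by (simp add: algebra_simps)
  ultimately show ?case by linarith
qed auto

text \<open>By parity one of the two summands is always 0, and the other is the maximum of \<^term>\<open>walk k\<close>.\<close>

definition cwalk :: "nat \<Rightarrow> real" where
  "cwalk k = walk k 0 + walk k 1"

lemma cwalk_nonneg: "0 \<le> cwalk k"
  by (simp add: cwalk_def walk_nonneg)

text \<open>For \<open>e \<ge> 0\<close> the ratio \<open>(k - e) / (k + e + 2)\<close> is at most
  1, so the walk does not increase in steps of two away from position 0 or 1.\<close>

lemma walk_le_cwalk_nat: "walk k (int d) \<le> cwalk k"
proof (induction d rule: less_induct)
  case (less d)
  consider "d = 0" | "d = 1" | e where "d = e + 2" by (metis One_nat_def Suc_eq_plus1 add_2_eq_Suc' not0_implies_Suc)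
  then show ?case
  proof cases
    case 3
    have r: "of_int (int k + int e + 2) * walk k (int e + 2) = of_int (int k - int e) * walk k (int e)"
      by (rule walk_ratio)
    have "of_int (int k - int e) * walk k (int e) \<le> of_int (int k + int e + 2) * walk k (int e)"
      by (intro mult_right_mono walk_nonneg) auto
    then have "of_int (int k + int e + 2) * walk k (int e + 2) \<le> of_int (int k + int e + 2) * walk k (int e)"
      using r by simp
    then have "walk k (int e + 2) \<le> walk k (int e)"
      by (subst (asm) mult_le_cancel_left_pos) auto
    then show ?thesis using less[of e] 3 by (simp add: add.commute)
  qed (auto simp: cwalk_def walk_nonneg)
qed

lemma walk_le_cwalk: "walk k d \<le> cwalk k"
  using walk_le_cwalk_nat[of k "nat d"] walk_le_cwalk_nat[of k "nat (- d)"] walk_minus[of k d]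
  by (cases "d \<ge> 0") auto

lemma cwalk_odd: "cwalk (Suc (2 * j)) = walk (Suc (2 * j)) 1"
  and cwalk_even: "cwalk (2 * j) = walk (2 * j) 0"
  by (simp_all add: cwalk_def walk_odd del: walk.simps)

text \<open>Position 1 at the odd time averages positions 0 and 2 one step earlier, and position 2
  carries \<open>2 j / (2 j + 2)\<close> times the mass of position 0.\<close>

lemma cwalk_Suc_odd: "cwalk (Suc (2 * j)) = (2 * real j + 1) / (2 * real j + 2) * cwalk (2 * j)"
proof -
  have "(2 * real j + 2) * walk (2 * j) 2 = 2 * real j * walk (2 * j) 0"
    using walk_ratio[of "2 * j" 0] by simp
  then show ?thesis unfolding cwalk_odd cwalk_even by (simp add: field_simps)
qed

text \<open>By symmetry the neighbours 1 and -1 of the origin carry equal mass, so averaging them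
  changes nothing.\<close>

lemma cwalk_Suc_even: "cwalk (Suc (Suc (2 * j))) = cwalk (Suc (2 * j))"
proof -
  have "cwalk (Suc (Suc (2 * j))) = walk (Suc (Suc (2 * j))) 0"
    using cwalk_even[of "Suc j"] by simp
  also have "\<dots> = (walk (Suc (2 * j)) (-1) + walk (Suc (2 * j)) 1) / 2"
    by (subst walk.simps) simp
  finally show ?thesis by (simp only: walk_minus cwalk_odd) simp
qed

section \<open>Wallis' product and the local limit at a fixed position\<close>

text \<open>The return probability is the product of the factors \<open>(2 i - 1) / (2 i)\<close>;
  its square times \<open>2 j + 1\<close> regroups into the reciprocal of a partial Wallis
  product.\<close>

lemma cwalk_wallis:
  "(cwalk (2 * j))\<^sup>2 * (2 * real j + 1) = inverse (\<Prod>k=1..j. (4*real k^2) / (4*real k^2 - 1))"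
proof (induction j)
  case 0
  then show ?case by (simp add: cwalk_def)
next
  case (Suc j)
  have c: "cwalk (2 * Suc j) = (2 * real j + 1) / (2 * real j + 2) * cwalk (2 * j)"
    using cwalk_Suc_even[of j] cwalk_Suc_odd[of j] by simp
  have e: "4 * (real (Suc j))\<^sup>2 - 1 = (2 * real j + 1) * (2 * real j + 3)"
    by (simp add: power2_eq_square algebra_simps)
  have "(cwalk (2 * Suc j))\<^sup>2 * (2 * real (Suc j) + 1)
      = ((cwalk (2 * j))\<^sup>2 * (2 * real j + 1)) * (((2 * real j + 1) * (2 * real j + 3)) / (4 * (real (Suc j))\<^sup>2))"
    unfolding c by (simp add: power2_eq_square field_simps)
  also have "\<dots> = inverse (\<Prod>k=1..j. (4*real k^2) / (4*real k^2 - 1)) * inverse (4 * (real (Suc j))\<^sup>2 / (4 * (real (Suc j))\<^sup>2 - 1))"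
    unfolding Suc e by (simp add: divide_simps)
  also have "\<dots> = inverse (\<Prod>k=1..Suc j. (4*real k^2) / (4*real k^2 - 1))"
    by (simp only: prod.nat_ivl_Suc'[of 1 j] inverse_mult_distrib mult.commute)
  finally show ?case .
qed

lemma cwalk_even_limit: "(\<lambda>j. sqrt (real (2 * j)) * cwalk (2 * j)) \<longlonglongrightarrow> sqrt (2 / pi)"
proof -
  have "(\<lambda>j. (cwalk (2 * j))\<^sup>2 * (2 * real j + 1)) \<longlonglongrightarrow> inverse (pi / 2)"
    unfolding cwalk_wallis by (intro tendsto_inverse wallis) auto
  moreover have "(\<lambda>j. 2 * real j / (2 * real j + 1)) \<longlonglongrightarrow> 1"
    by real_asymp
  ultimately have "(\<lambda>j. sqrt ((cwalk (2 * j))\<^sup>2 * (2 * real j + 1) * (2 * real j / (2 * real j + 1)))) \<longlonglongrightarrow> sqrt (inverse (pi / 2) * 1)"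
    by (intro tendsto_intros)
  moreover have "sqrt ((cwalk (2 * j))\<^sup>2 * (2 * real j + 1) * (2 * real j / (2 * real j + 1))) = sqrt (real (2 * j)) * cwalk (2 * j)" for j
  proof -
    have "(cwalk (2 * j))\<^sup>2 * (2 * real j + 1) * (2 * real j / (2 * real j + 1)) = real (2 * j) * (cwalk (2 * j))\<^sup>2"
      by (simp add: field_simps)
    then show ?thesis by (simp add: real_sqrt_mult cwalk_nonneg)
  qed
  ultimately show ?thesis by simp
qed

lemma cwalk_limit: "(\<lambda>k. sqrt (real k) * cwalk k) \<longlonglongrightarrow> sqrt (2 / pi)"
proof (rule limseq_even_odd)
  have "(\<lambda>j. sqrt ((2 * real j + 1) / (2 * real j)) * ((2 * real j + 1) / (2 * real j + 2))) \<longlonglongrightarrow> 1"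
    by real_asymp
  from tendsto_mult[OF this cwalk_even_limit]
  have "(\<lambda>j. sqrt ((2 * real j + 1) / (2 * real j)) * ((2 * real j + 1) / (2 * real j + 2)) * (sqrt (real (2 * j)) * cwalk (2 * j))) \<longlonglongrightarrow> sqrt (2 / pi)"
    by simp
  moreover have "\<forall>\<^sub>F j in sequentially. sqrt ((2 * real j + 1) / (2 * real j)) * ((2 * real j + 1) / (2 * real j + 2)) * (sqrt (real (2 * j)) * cwalk (2 * j)) = sqrt (real (2 * j + 1)) * cwalk (2 * j + 1)"
    using eventually_gt_at_top[of 0]
  proof eventually_elim
    case (elim j)
    have "sqrt ((2 * real j + 1) / (2 * real j)) * sqrt (real (2 * j)) = sqrt (real (2 * j + 1))"
      unfolding real_sqrt_mult[symmetric] using elim by (simp add: add.commute)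
    then show ?case using cwalk_Suc_odd[of j] by (simp add: mult_ac)
  qed
  ultimately show "(\<lambda>j. sqrt (real (2 * j + 1)) * cwalk (2 * j + 1)) \<longlonglongrightarrow> sqrt (2 / pi)"
    by (rule Lim_transform_eventually)
qed (rule cwalk_even_limit)

text \<open>For fixed \<open>d\<close> the scaled probability alternates between 0 and values near
  \<open>sqrt (2 / pi)\<close>; subtracting the parity indicator gives a null sequence. The limit
  passes from \<open>d\<close> to \<open>d + 2\<close> because the ratio of the two probabilities
  tends to 1.\<close>

lemma walk_limit_nat:
  "(\<lambda>k. sqrt (real k) * walk k (int d) - of_bool (even (int k + int d)) * sqrt (2 / pi)) \<longlonglongrightarrow> 0"
proof (induction d rule: less_induct)
  case (less d)
  have base: "(\<lambda>k. sqrt (real k) * walk k e - of_bool (even (int k + e)) * sqrt (2 / pi)) \<longlonglongrightarrow> 0"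
    if e: "e = 0 \<or> e = 1" for e
  proof (rule Lim_null_comparison)
    show "(\<lambda>k. \<bar>sqrt (real k) * cwalk k - sqrt (2 / pi)\<bar>) \<longlonglongrightarrow> 0"
      by (intro tendsto_rabs_zero LIM_zero cwalk_limit)
    have "walk k e = of_bool (even (int k + e)) * cwalk k" for k
      using e walk_odd[of k e] walk_odd[of k 0] walk_odd[of k 1] by (auto simp: cwalk_def)
    then show "\<forall>\<^sub>F k in sequentially. norm (sqrt (real k) * walk k e - of_bool (even (int k + e)) * sqrt (2 / pi)) \<le> \<bar>sqrt (real k) * cwalk k - sqrt (2 / pi)\<bar>"
      by (intro always_eventually) auto
  qed
  consider "d = 0" | "d = 1" | e where "d = e + 2" by (metis One_nat_def Suc_eq_plus1 add_2_eq_Suc' not0_implies_Suc)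
  then show ?case
  proof cases
    case 3
    let ?r = "\<lambda>k. (real k - real e) / (real k + real e + 2)"
    have r: "?r \<longlonglongrightarrow> 1" by real_asymp
    have r': "(\<lambda>k. (?r k - 1) * sqrt (2 / pi)) \<longlonglongrightarrow> 0"
      using tendsto_mult_left_zero[OF LIM_zero[OF r]] by simp
    have b: "\<bar>of_bool (even (int k + int e)) * ((?r k - 1) * sqrt (2 / pi))\<bar> \<le> \<bar>(?r k - 1) * sqrt (2 / pi)\<bar>" for k
      by auto
    have r'': "(\<lambda>k. of_bool (even (int k + int e)) * ((?r k - 1) * sqrt (2 / pi))) \<longlonglongrightarrow> 0"
      by (rule tendsto_rabs_zero_cancel, rule tendsto_sandwich[OF _ _ tendsto_const tendsto_rabs_zero[OF r']])
        (use b in auto)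
    \<comment> \<open>The error at \<open>d = e + 2\<close> is the ratio times the error at
      \<open>e\<close> plus the ratio's own deviation from 1; both positions share the parity
      indicator.\<close>
    have "(\<lambda>k. ?r k * (sqrt (real k) * walk k (int e) - of_bool (even (int k + int e)) * sqrt (2 / pi))
        + of_bool (even (int k + int e)) * ((?r k - 1) * sqrt (2 / pi))) \<longlonglongrightarrow> 1 * 0 + 0"
      using less[of e] 3 by (intro tendsto_intros r r'') auto
    moreover have "?r k * (sqrt (real k) * walk k (int e) - of_bool (even (int k + int e)) * sqrt (2 / pi))
        + of_bool (even (int k + int e)) * ((?r k - 1) * sqrt (2 / pi))
        = sqrt (real k) * walk k (int d) - of_bool (even (int k + int d)) * sqrt (2 / pi)" for k
    proof -
      have "(real k + real e + 2) * walk k (int d) = (real k - real e) * walk k (int e)"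
        using walk_ratio[of k "int e"] 3 by (simp add: add.commute)
      then have "walk k (int d) = ?r k * walk k (int e)"
        by (simp add: field_simps)
      then show ?thesis using 3 by (simp add: algebra_simps)
    qed
    ultimately show ?thesis by simp
  qed (use base[of 0] base[of 1] in auto)
qed

lemma walk_limit:
  "(\<lambda>k. sqrt (real k) * walk k d - of_bool (even (int k + d)) * sqrt (2 / pi)) \<longlonglongrightarrow> 0"
proof (cases "d \<ge> 0")
  case True
  then show ?thesis using walk_limit_nat[of "nat d"] by simp
next
  case False
  then show ?thesis using walk_limit_nat[of "nat (- d)"] by (simp add: walk_minus)
qed

subsection \<open>Averages against the binomial distribution\<close>

text \<open>The pairs (n, k) with n tending to infinity and k / n tending to x, on which the binomial
  distribution with parameters n and x concentrates.\<close>

definition lln_filter :: "real \<Rightarrow> (nat \<times> nat) filter" where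
  "lln_filter x = inf (filtercomap fst at_top) (filtercomap (\<lambda>(n, k). real k / real n) (nhds x))"

lemma lln_filter_fst: "filterlim fst at_top (lln_filter x)"
  unfolding lln_filter_def by (rule filterlim_mono[OF filterlim_filtercomap]) auto

lemma lln_filter_ratio: "((\<lambda>(n, k). real k / real n) \<longlongrightarrow> x) (lln_filter x)"
  unfolding lln_filter_def by (rule filterlim_mono[OF filterlim_filtercomap]) auto

lemma lln_filter_real_fst: "filterlim (\<lambda>(n, k). real n) at_top (lln_filter x)"
  using filterlim_compose[OF filterlim_real_sequentially lln_filter_fst[of x]]
  by (simp add: case_prod_unfold)

lemma lln_filter_pos: "\<forall>\<^sub>F (n, k) in lln_filter x. n > 0"
  using eventually_compose_filterlim[OF eventually_gt_at_top[of 0] lln_filter_fst[of x]]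
  by (simp add: case_prod_unfold)

lemma lln_filter_less:
  assumes "x < 1"
  shows "\<forall>\<^sub>F (n, k) in lln_filter x. k < n"
  using order_tendstoD(2)[OF lln_filter_ratio assms] lln_filter_pos[of x]
  by eventually_elim auto

lemma filterlim_nat_real: "filterlim (\<lambda>p. real (f p)) at_top F \<Longrightarrow> filterlim f at_top F"
  unfolding filterlim_at_top by (metis (mono_tags, lifting) eventually_mono of_nat_le_iff)

text \<open>Here \<open>k = (k / n) * n\<close> with \<open>k / n\<close> near a positive number.
  With the analogous fact for \<open>n - k\<close>, limits of the walk can be composed with both
  step counts.\<close>

lemma lln_filter_snd:
  assumes "0 < x"
  shows "filterlim snd at_top (lln_filter x)"
proof -
  have "filterlim (\<lambda>p. (case p of (n, k) \<Rightarrow> real k / real n) * (case p of (n, k) \<Rightarrow> real n)) at_top (lln_filter x)"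
    by (rule filterlim_tendsto_pos_mult_at_top[OF lln_filter_ratio assms lln_filter_real_fst])
  moreover have "\<forall>\<^sub>F p in lln_filter x. (case p of (n, k) \<Rightarrow> real k / real n) * (case p of (n, k) \<Rightarrow> real n) = real (snd p)"
    using lln_filter_pos[of x] by eventually_elim auto
  ultimately have "filterlim (\<lambda>p. real (snd p)) at_top (lln_filter x)"
    by (subst (asm) filterlim_cong[OF refl refl]) auto
  then show ?thesis by (rule filterlim_nat_real)
qed

lemma lln_filter_diff:
  assumes "x < 1"
  shows "filterlim (\<lambda>p. fst p - snd p) at_top (lln_filter x)"
proof -
  have "filterlim (\<lambda>p. (1 - (case p of (n, k) \<Rightarrow> real k / real n)) * (case p of (n, k) \<Rightarrow> real n)) at_top (lln_filter x)"
    using assms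
    by (intro filterlim_tendsto_pos_mult_at_top[OF tendsto_diff[OF tendsto_const lln_filter_ratio] _ lln_filter_real_fst]) auto
  moreover have "\<forall>\<^sub>F p in lln_filter x. (1 - (case p of (n, k) \<Rightarrow> real k / real n)) * (case p of (n, k) \<Rightarrow> real n) = real (fst p - snd p)"
    using lln_filter_less[OF assms] by eventually_elim (auto simp: field_simps of_nat_diff)
  ultimately have "filterlim (\<lambda>p. real (fst p - snd p)) at_top (lln_filter x)"
    by (subst (asm) filterlim_cong[OF refl refl]) auto
  then show ?thesis by (rule filterlim_nat_real)
qed

section \<open>Concentration of the binomial distribution\<close>

text \<open>The binomial variance, from the known averages of 1, \<open>k\<close> and
  \<open>k * (k - 1)\<close>.\<close>

lemma sum_sq_Bernstein: "(\<Sum>k\<le>n. (real k - real n * x)\<^sup>2 * Bernstein n k x) = real n * x * (1 - x)"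
proof -
  have *: "(a - b)\<^sup>2 * y = a * (a - 1) * y + (1 - 2 * b) * (a * y) + b * b * y" for a b y :: real
    by (simp add: algebra_simps power2_eq_square)
  show ?thesis
    by (simp only: * sum.distrib sum_distrib_left[symmetric] sum_k_Bernstein sum_kk_Bernstein sum_Bernstein)
      (simp add: algebra_simps power2_eq_square)
qed

text \<open>Chebyshev's inequality, with the variance factor \<open>x * (1 - x)\<close> bounded by
  1.\<close>

lemma Bernstein_tail:
  assumes "0 \<le> x" "x \<le> 1" "0 < \<eta>" "0 < n"
  shows "(\<Sum>k\<le>n. of_bool (\<bar>real k / real n - x\<bar> \<ge> \<eta>) * Bernstein n k x) \<le> 1 / (\<eta>\<^sup>2 * real n)"
proof -
  have "(\<Sum>k\<le>n. of_bool (\<bar>real k / real n - x\<bar> \<ge> \<eta>) * Bernstein n k x)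
      \<le> (\<Sum>k\<le>n. (real k - real n * x)\<^sup>2 * Bernstein n k x / (\<eta> * real n)\<^sup>2)"
  proof (rule sum_mono)
    fix k
    have "1 \<le> (real k - real n * x)\<^sup>2 / (\<eta> * real n)\<^sup>2" if "\<bar>real k / real n - x\<bar> \<ge> \<eta>"
    proof -
      have "real k - real n * x = (real k / real n - x) * real n"
        using assms by (simp add: field_simps)
      then have "\<eta> * real n \<le> \<bar>real k - real n * x\<bar>"
        using that by (simp add: abs_mult mult_right_mono)
      then have "(\<eta> * real n)\<^sup>2 \<le> (real k - real n * x)\<^sup>2"
        using assms by (metis abs_ge_zero less_eq_real_def mult_nonneg_nonneg of_nat_0_le_iff power2_abs power_mono)
      then show ?thesis using assms by simp
    qed
    then have "of_bool (\<bar>real k / real n - x\<bar> \<ge> \<eta>) \<le> (real k - real n * x)\<^sup>2 / (\<eta> * real n)\<^sup>2"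
      by auto
    from mult_right_mono[OF this Bernstein_nonneg[OF assms(1,2), of n k]]
    show "of_bool (\<bar>real k / real n - x\<bar> \<ge> \<eta>) * Bernstein n k x
      \<le> (real k - real n * x)\<^sup>2 * Bernstein n k x / (\<eta> * real n)\<^sup>2" by simp
  qed
  also have "\<dots> = real n * (x * (1 - x)) / (\<eta> * real n)\<^sup>2"
    by (simp only: sum_divide_distrib[symmetric] sum_sq_Bernstein mult.assoc)
  also have "\<dots> \<le> real n * 1 / (\<eta> * real n)\<^sup>2"
    using assms by (intro divide_right_mono mult_left_mono mult_le_one) auto
  also have "\<dots> = 1 / (\<eta>\<^sup>2 * real n)"
    using assms by (simp add: power2_eq_square)
  finally show ?thesis .
qed

text \<open>Close to the mean \<open>h\<close> is small; away from it the growth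
  \<open>C * sqrt n\<close> is beaten by the tail weight of order \<open>1 / n\<close>.\<close>

lemma Bernstein_average_null:
  fixes h :: "nat \<Rightarrow> nat \<Rightarrow> real"
  assumes x: "0 \<le> x" "x \<le> 1"
    and lim: "((\<lambda>(n, k). h n k) \<longlongrightarrow> 0) (lln_filter x)"
    and bound: "\<And>n k. 0 < n \<Longrightarrow> k \<le> n \<Longrightarrow> \<bar>h n k\<bar> \<le> C * sqrt (real n)"
  shows "(\<lambda>n. \<Sum>k\<le>n. Bernstein n k x * h n k) \<longlonglongrightarrow> 0"
proof (rule tendstoI)
  fix \<epsilon> :: real assume \<epsilon>: "\<epsilon> > 0"
  have C: "0 \<le> C" using bound[of 1 0] by auto
  have "\<forall>\<^sub>F (n, k) in lln_filter x. \<bar>h n k\<bar> < \<epsilon> / 2"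
    using tendstoD[OF lim, of "\<epsilon> / 2"] \<epsilon> by (simp add: case_prod_unfold)
  \<comment> \<open>\<open>Q\<close> holds for large \<open>n\<close> and \<open>R\<close> for
    \<open>k / n\<close> close to \<open>x\<close>; they yield the threshold \<open>N\<close> and
    the radius \<open>\<eta>\<close>.\<close>
  then obtain Q R where Q: "eventually Q (filtercomap fst at_top)"
    and R: "eventually R (filtercomap (\<lambda>(n, k). real k / real n) (nhds x))"
    and QR: "\<And>n k. Q (n, k) \<Longrightarrow> R (n, k) \<Longrightarrow> \<bar>h n k\<bar> < \<epsilon> / 2"
    unfolding lln_filter_def eventually_inf by auto
  obtain N :: nat where N: "\<And>n k. n \<ge> N \<Longrightarrow> Q (n, k)"
    using Q unfolding eventually_filtercomap_at_top_linorder by auto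
  obtain S where "eventually S (nhds x)" and S: "\<And>n k. S (real k / real n) \<Longrightarrow> R (n, k)"
    using R unfolding eventually_filtercomap by auto
  then obtain \<eta> where \<eta>: "\<eta> > 0" "\<And>y. \<bar>y - x\<bar> < \<eta> \<Longrightarrow> S y"
    unfolding eventually_nhds_metric dist_real_def by blast
  have "(\<lambda>n. C * sqrt (real n) * (1 / (\<eta>\<^sup>2 * real n))) \<longlonglongrightarrow> 0"
    using \<eta>(1) by real_asymp
  then have "\<forall>\<^sub>F n in sequentially. C * sqrt (real n) * (1 / (\<eta>\<^sup>2 * real n)) < \<epsilon> / 2"
    using \<epsilon> by (intro order_tendstoD) auto
  then show "\<forall>\<^sub>F n in sequentially. dist (\<Sum>k\<le>n. Bernstein n k x * h n k) 0 < \<epsilon>"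
    using eventually_ge_at_top[of N] eventually_gt_at_top[of 0]
  proof eventually_elim
    case (elim n)
    have "\<bar>\<Sum>k\<le>n. Bernstein n k x * h n k\<bar> \<le> (\<Sum>k\<le>n. \<bar>Bernstein n k x * h n k\<bar>)"
      by (rule sum_abs)
    also have "\<dots> \<le> (\<Sum>k\<le>n. Bernstein n k x * (\<epsilon> / 2) + C * sqrt (real n) * (of_bool (\<bar>real k / real n - x\<bar> \<ge> \<eta>) * Bernstein n k x))"
    proof (rule sum_mono)
      fix k assume "k \<in> {..n}"
      then have "\<bar>h n k\<bar> \<le> \<epsilon> / 2 + C * sqrt (real n) * of_bool (\<bar>real k / real n - x\<bar> \<ge> \<eta>)"
        using QR[OF N[OF elim(2)] S[OF \<eta>(2)], of k] bound[of n k] elim(3) \<epsilon>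
        by (cases "\<bar>real k / real n - x\<bar> \<ge> \<eta>") auto
      from mult_left_mono[OF this Bernstein_nonneg[OF x, of n k]]
      show "\<bar>Bernstein n k x * h n k\<bar> \<le> Bernstein n k x * (\<epsilon> / 2) + C * sqrt (real n) * (of_bool (\<bar>real k / real n - x\<bar> \<ge> \<eta>) * Bernstein n k x)"
        using Bernstein_nonneg[OF x, of n k] by (simp add: abs_mult algebra_simps)
    qed
    also have "\<dots> = \<epsilon> / 2 + C * sqrt (real n) * (\<Sum>k\<le>n. of_bool (\<bar>real k / real n - x\<bar> \<ge> \<eta>) * Bernstein n k x)"
      by (simp only: sum.distrib sum_distrib_left[symmetric] sum_distrib_right[symmetric] sum_Bernstein mult_1)
    also have "\<dots> \<le> \<epsilon> / 2 + C * sqrt (real n) * (1 / (\<eta>\<^sup>2 * real n))"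
      using elim C x \<eta> by (intro add_left_mono mult_left_mono Bernstein_tail) auto
    also have "\<dots> < \<epsilon>" using elim by linarith
    finally show ?case by simp
  qed
qed

text \<open>The binomial generating function at -1 is \<open>(1 - 2 * x) ^ n\<close>, which tends to
  0, so even and odd \<open>k\<close> are asymptotically equally likely.\<close>

lemma Bernstein_parity:
  assumes "0 < x" "x < 1"
  shows "(\<lambda>n. \<Sum>k\<le>n. Bernstein n k x * of_bool (even (int k + d))) \<longlonglongrightarrow> 1 / 2"
proof -
  have alt: "(\<Sum>k\<le>n. Bernstein n k x * (- 1) ^ k) = (1 - 2 * x) ^ n" for n
  proof -
    have "(1 - 2 * x) ^ n = (- x + (1 - x)) ^ n" by simp
    also have "\<dots> = (\<Sum>k\<le>n. of_nat (n choose k) * (- x) ^ k * (1 - x) ^ (n - k))"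
      by (rule binomial_ring)
    also have "\<dots> = (\<Sum>k\<le>n. Bernstein n k x * (- 1) ^ k)"
      by (intro sum.cong refl) (simp add: Bernstein_def power_minus[of x] mult_ac)
    finally show ?thesis by simp
  qed
  define \<sigma> :: real where "\<sigma> = (if even d then 1 else - 1)"
  have "of_bool (even (int k + d)) = (1 + \<sigma> * (- 1) ^ k) / 2" for k
    by (auto simp: \<sigma>_def minus_one_power_iff)
  then have "(\<Sum>k\<le>n. Bernstein n k x * of_bool (even (int k + d))) = (1 + \<sigma> * (1 - 2 * x) ^ n) / 2" for n
    by (simp only: alt[symmetric] times_divide_eq_right sum_divide_distrib[symmetric] distrib_left
        mult_1_right sum.distrib sum_Bernstein mult.left_commute[of _ \<sigma>] sum_distrib_left)
  moreover have "(\<lambda>n. (1 + \<sigma> * (1 - 2 * x) ^ n) / 2) \<longlonglongrightarrow> (1 + \<sigma> * 0) / 2"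
    using assms by (intro tendsto_intros LIMSEQ_power_zero) auto
  ultimately show ?thesis by (simp only:) simp
qed

section \<open>Products of two walks under a binomial mixture\<close>

lemma cwalk_sqrt_bounded: obtains C where "\<And>k. sqrt (real k) * cwalk k \<le> C"
proof -
  have "Bseq (\<lambda>k. sqrt (real k) * cwalk k)"
    using cwalk_limit by (intro convergent_imp_Bseq) (auto simp: convergent_def)
  then obtain C where "\<And>k. norm (sqrt (real k) * cwalk k) \<le> C"
    unfolding Bseq_def by blast
  then show ?thesis by (intro that[of C]) (metis abs_le_D1 real_norm_def)
qed

lemma walk_le_1: "walk k d \<le> 1"
proof (induction k arbitrary: d)
  case (Suc k)
  show ?case using Suc[of "d - 1"] Suc[of "d + 1"] by simp
qed auto

lemma cwalk_le_1: "cwalk k \<le> 1"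
  using walk_le_1[of k 0] walk_le_1[of k 1] walk_odd[of k 0] walk_odd[of k 1]
  by (cases "even k") (auto simp: cwalk_def)

text \<open>After splitting \<open>sqrt n \<le> sqrt (n - k) + sqrt k\<close>, each root is absorbed
  by its own walk and the other walk is bounded by 1. The order \<open>sqrt n\<close> is attained
  for \<open>k\<close> near 0 or \<open>n\<close>, where the binomial weight is small.\<close>

lemma cwalk_product_bound:
  obtains C where "\<And>n k. k \<le> n \<Longrightarrow> real n * (cwalk (n - k) * cwalk k) \<le> C * sqrt (real n)"
proof -
  obtain C where C: "\<And>k. sqrt (real k) * cwalk k \<le> C"
    using cwalk_sqrt_bounded by blast
  have "real n * (cwalk (n - k) * cwalk k) \<le> (2 * C) * sqrt (real n)" if "k \<le> n" for n k
  proof -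
    have "sqrt (real n) \<le> sqrt (real (n - k)) + sqrt (real k)"
      using sqrt_add_le_add_sqrt[of "real (n - k)" "real k"] that by (simp add: of_nat_diff)
    then have "sqrt (real n) * (cwalk (n - k) * cwalk k) \<le> (sqrt (real (n - k)) + sqrt (real k)) * (cwalk (n - k) * cwalk k)"
      by (intro mult_right_mono mult_nonneg_nonneg cwalk_nonneg)
    also have "\<dots> = sqrt (real (n - k)) * cwalk (n - k) * cwalk k + sqrt (real k) * cwalk k * cwalk (n - k)"
      by (simp add: algebra_simps)
    also have "\<dots> \<le> sqrt (real (n - k)) * cwalk (n - k) * 1 + sqrt (real k) * cwalk k * 1"
      by (intro add_mono mult_left_mono cwalk_le_1 mult_nonneg_nonneg cwalk_nonneg) auto
    also have "\<dots> \<le> 2 * C" using C[of "n - k"] C[of k] by simp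
    finally have "sqrt (real n) * (sqrt (real n) * (cwalk (n - k) * cwalk k)) \<le> sqrt (real n) * (2 * C)"
      by (intro mult_left_mono) auto
    moreover have "sqrt (real n) * (sqrt (real n) * (cwalk (n - k) * cwalk k)) = real n * (cwalk (n - k) * cwalk k)"
      by (simp flip: mult.assoc)
    ultimately show ?thesis by (simp only: mult_ac)
  qed
  then show ?thesis by (rule that)
qed


lemma tendsto_of_bool_mult_null:
  fixes f :: "'a \<Rightarrow> real"
  assumes "(f \<longlongrightarrow> 0) F"
  shows "((\<lambda>p. of_bool (P p) * f p) \<longlongrightarrow> 0) F"
  by (rule Lim_null_comparison[OF _ tendsto_rabs_zero[OF assms]]) (auto intro!: always_eventually)

lemma lln_filter_scale:
  assumes "0 < x" "x < 1"
  shows "((\<lambda>(n, k). real n / (sqrt (real (n - k)) * sqrt (real k))) \<longlongrightarrow> 1 / sqrt (x * (1 - x))) (lln_filter x)"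
proof -
  have "((\<lambda>p. 1 / sqrt ((case p of (n, k) \<Rightarrow> real k / real n) * (1 - (case p of (n, k) \<Rightarrow> real k / real n))))
      \<longlongrightarrow> 1 / sqrt (x * (1 - x))) (lln_filter x)"
    using assms by (intro tendsto_intros lln_filter_ratio) auto
  moreover have "\<forall>\<^sub>F p in lln_filter x. 1 / sqrt ((case p of (n, k) \<Rightarrow> real k / real n) * (1 - (case p of (n, k) \<Rightarrow> real k / real n)))
      = (case p of (n, k) \<Rightarrow> real n / (sqrt (real (n - k)) * sqrt (real k)))"
    using lln_filter_less[OF assms(2)]
  proof eventually_elim
    case (elim p)
    obtain n k where p: "p = (n, k)" by (cases p)
    have "real k / real n * (1 - real k / real n) = real (n - k) * real k / (real n)\<^sup>2"
      using elim p by (simp add: of_nat_diff field_simps power2_eq_square)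
    then show ?case by (simp add: p real_sqrt_divide real_sqrt_mult)
  qed
  ultimately show ?thesis by (rule Lim_transform_eventually)
qed

text \<open>Write the scaled factors as \<open>U + P c\<close> and \<open>V + P c\<close> and
  expand: apart from the limiting term, every term contains a null factor. The general
  \<open>P\<close> covers both the parity constraint and, when constantly true, the majorant
  \<open>cwalk\<close>.\<close>

lemma lln_filter_product:
  fixes f g :: "nat \<times> nat \<Rightarrow> real"
  assumes x: "0 < x" "x < 1"
    and f: "((\<lambda>p. sqrt (real (fst p - snd p)) * f p - of_bool (P p) * c) \<longlongrightarrow> 0) (lln_filter x)"
    and g: "((\<lambda>p. sqrt (real (snd p)) * g p - of_bool (P p) * c) \<longlongrightarrow> 0) (lln_filter x)"
  shows "((\<lambda>p. real (fst p) * (f p * g p) - of_bool (P p) * (c\<^sup>2 / sqrt (x * (1 - x)))) \<longlongrightarrow> 0) (lln_filter x)"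
proof -
  let ?U = "\<lambda>p. sqrt (real (fst p - snd p)) * f p - of_bool (P p) * c"
  let ?V = "\<lambda>p. sqrt (real (snd p)) * g p - of_bool (P p) * c"
  let ?A = "\<lambda>p. real (fst p) / (sqrt (real (fst p - snd p)) * sqrt (real (snd p)))"
  let ?G = "1 / sqrt (x * (1 - x))"
  have A: "(?A \<longlongrightarrow> ?G) (lln_filter x)"
    using lln_filter_scale[OF x] by (simp add: case_prod_unfold)
  have 1: "((\<lambda>p. ?A p * ?U p * ?V p) \<longlongrightarrow> ?G * 0 * 0) (lln_filter x)"
    by (intro tendsto_mult A f g)
  have 2: "((\<lambda>p. of_bool (P p) * (?A p * c * (?U p + ?V p))) \<longlongrightarrow> 0) (lln_filter x)"
  proof (rule tendsto_of_bool_mult_null)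
    have "((\<lambda>p. ?A p * c * (?U p + ?V p)) \<longlongrightarrow> ?G * c * (0 + 0)) (lln_filter x)"
      by (intro tendsto_mult tendsto_add tendsto_const A f g)
    then show "((\<lambda>p. ?A p * c * (?U p + ?V p)) \<longlongrightarrow> 0) (lln_filter x)" by simp
  qed
  have 3: "((\<lambda>p. of_bool (P p) * ((?A p - ?G) * c\<^sup>2)) \<longlongrightarrow> 0) (lln_filter x)"
    by (intro tendsto_of_bool_mult_null tendsto_mult_left_zero LIM_zero A)
  have "((\<lambda>p. ?A p * ?U p * ?V p + of_bool (P p) * (?A p * c * (?U p + ?V p)) + of_bool (P p) * ((?A p - ?G) * c\<^sup>2))
      \<longlongrightarrow> 0) (lln_filter x)"
    using tendsto_add[OF tendsto_add[OF 1 2] 3] by simp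
  moreover have "\<forall>\<^sub>F p in lln_filter x. ?A p * ?U p * ?V p + of_bool (P p) * (?A p * c * (?U p + ?V p)) + of_bool (P p) * ((?A p - ?G) * c\<^sup>2)
      = real (fst p) * (f p * g p) - of_bool (P p) * (c\<^sup>2 / sqrt (x * (1 - x)))"
    using lln_filter_less[OF x(2)] eventually_compose_filterlim[OF eventually_gt_at_top[of 0] lln_filter_snd[OF x(1)]]
  proof eventually_elim
    case (elim p)
    define a b where "a = sqrt (real (fst p - snd p))" and "b = sqrt (real (snd p))"
    have ab: "a > 0" "b > 0" using elim by (auto simp: a_def b_def case_prod_unfold)
    define q where "q = real (fst p) / (a * b)"
    have q: "real (fst p) = q * (a * b)" using ab by (simp add: q_def)
    define G where "G = ?G"
    have G: "c\<^sup>2 / sqrt (x * (1 - x)) = c\<^sup>2 * G" by (simp add: G_def)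
    show ?case
      unfolding G q a_def[symmetric] b_def[symmetric] G_def[symmetric]
      using ab by (cases "P p") (simp_all add: algebra_simps power2_eq_square)
  qed
  ultimately show ?thesis by (rule Lim_transform_eventually)
qed

text \<open>By \<open>par\<close> the two walks have the same parity constraint,
  \<open>k + d\<close> even, which half of the binomial mass satisfies; so the limit is half of
  \<open>(2 / pi) / sqrt (x * (1 - x))\<close>. Two offsets \<open>e0\<close> and \<open>e1\<close>
  are needed since the majority threshold depends on the parity of \<open>n\<close>.\<close>

lemma walk_convolution_limit:
  assumes x: "0 < x" "x < 1" and par: "\<And>n. even (int n + (if even n then e0 else e1) + d)"
  shows "(\<lambda>n. real n * (\<Sum>k\<le>n. Bernstein n k x * (walk (n - k) (if even n then e0 else e1) * walk k d)))
           \<longlonglongrightarrow> 1 / (pi * sqrt (x * (1 - x)))"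
proof -
  define e where "e n = (if even n then e0 else e1)" for n :: nat
  define c where "c = sqrt (2 / pi)"
  define L where "L = c\<^sup>2 / sqrt (x * (1 - x))"
  have L: "L \<ge> 0" using x by (simp add: L_def)
  define h where "h n k = real n * (walk (n - k) (e n) * walk k d) - of_bool (even (int k + d)) * L" for n k
  obtain C where C: "\<And>n k. k \<le> n \<Longrightarrow> real n * (cwalk (n - k) * cwalk k) \<le> C * sqrt (real n)"
    using cwalk_product_bound by blast
  have bound: "\<bar>h n k\<bar> \<le> (C + L) * sqrt (real n)" if "0 < n" "k \<le> n" for n k
  proof -
    have "real n * (walk (n - k) (e n) * walk k d) \<le> real n * (cwalk (n - k) * cwalk k)"
      by (intro mult_left_mono mult_mono walk_le_cwalk walk_nonneg cwalk_nonneg) auto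
    moreover have "0 \<le> real n * (walk (n - k) (e n) * walk k d)"
      by (intro mult_nonneg_nonneg walk_nonneg) auto
    moreover have "of_bool (even (int k + d)) * L \<le> L * sqrt (real n)"
      using L that mult_left_mono[of 1 "sqrt (real n)" L] by auto
    moreover have "0 \<le> of_bool (even (int k + d)) * L" using L by auto
    ultimately show ?thesis using C[OF that(2)] unfolding h_def by (simp only: abs_le_iff distrib_right) linarith
  qed
  \<comment> \<open>The errors are added so that one null sequence dominates whichever offset the
    parity of \<open>n\<close> selects.\<close>
  have lim_e: "(\<lambda>k. \<bar>sqrt (real k) * walk k e0 - of_bool (even (int k + e0)) * c\<bar> + \<bar>sqrt (real k) * walk k e1 - of_bool (even (int k + e1)) * c\<bar>) \<longlonglongrightarrow> 0"
    using tendsto_add[OF tendsto_rabs_zero[OF walk_limit[of e0]] tendsto_rabs_zero[OF walk_limit[of e1]]] by (simp add: c_def)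
  have f: "((\<lambda>p. sqrt (real (fst p - snd p)) * walk (fst p - snd p) (e (fst p)) - of_bool (even (int (snd p) + d)) * c) \<longlongrightarrow> 0) (lln_filter x)"
  proof (rule Lim_null_comparison[OF _ filterlim_compose[OF lim_e lln_filter_diff[OF x(2)]]])
    show "\<forall>\<^sub>F p in lln_filter x. norm (sqrt (real (fst p - snd p)) * walk (fst p - snd p) (e (fst p)) - of_bool (even (int (snd p) + d)) * c)
      \<le> \<bar>sqrt (real (fst p - snd p)) * walk (fst p - snd p) e0 - of_bool (even (int (fst p - snd p) + e0)) * c\<bar>
        + \<bar>sqrt (real (fst p - snd p)) * walk (fst p - snd p) e1 - of_bool (even (int (fst p - snd p) + e1)) * c\<bar>"
      using lln_filter_less[OF x(2)]
    proof eventually_elim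
      case (elim p)
      then have "int (fst p - snd p) = int (fst p) - int (snd p)" by (auto simp: of_nat_diff)
      then have "even (int (snd p) + d) = even (int (fst p - snd p) + e (fst p))"
        using par[of "fst p"] unfolding e_def[symmetric] by presburger
      then show ?case by (auto simp: e_def)
    qed
  qed
  have g: "((\<lambda>p. sqrt (real (snd p)) * walk (snd p) d - of_bool (even (int (snd p) + d)) * c) \<longlongrightarrow> 0) (lln_filter x)"
    using filterlim_compose[OF walk_limit[of d] lln_filter_snd[OF x(1)]] by (simp add: c_def)
  have "((\<lambda>(n, k). h n k) \<longlongrightarrow> 0) (lln_filter x)"
    using lln_filter_product[OF x f g] by (simp add: case_prod_unfold h_def L_def)
  then have "(\<lambda>n. \<Sum>k\<le>n. Bernstein n k x * h n k) \<longlonglongrightarrow> 0"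
    using x bound by (intro Bernstein_average_null[of _ _ "C + L"]) auto
  from tendsto_add[OF this tendsto_mult_left[OF Bernstein_parity[OF x, of d], of L]]
  have "(\<lambda>n. (\<Sum>k\<le>n. Bernstein n k x * h n k) + L * (\<Sum>k\<le>n. Bernstein n k x * of_bool (even (int k + d)))) \<longlonglongrightarrow> L / 2"
    by (simp only: add_0 times_divide_eq_right mult_1_right)
  moreover have "(\<Sum>k\<le>n. Bernstein n k x * h n k) + L * (\<Sum>k\<le>n. Bernstein n k x * of_bool (even (int k + d)))
      = real n * (\<Sum>k\<le>n. Bernstein n k x * (walk (n - k) (e n) * walk k d))" for n
    unfolding sum_distrib_left sum.distrib[symmetric] by (intro sum.cong refl) (simp add: h_def algebra_simps)
  moreover have "L / 2 = 1 / (pi * sqrt (x * (1 - x)))"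
    by (simp add: L_def c_def)
  ultimately show ?thesis by (simp only: e_def)
qed

text \<open>Replacing both walks by \<open>cwalk\<close> makes the bound uniform in the positions,
  as dominated convergence requires.\<close>

lemma walk_convolution_bounded:
  assumes x: "0 < x" "x < 1"
  obtains M where "\<And>n d e. real n * (\<Sum>k\<le>n. Bernstein n k x * (walk (n - k) e * walk k d)) \<le> M"
proof -
  define c where "c = sqrt (2 / pi)"
  define L where "L = c\<^sup>2 / sqrt (x * (1 - x))"
  have L: "L \<ge> 0" using x by (simp add: L_def)
  define h where "h n k = real n * (cwalk (n - k) * cwalk k) - L" for n k
  obtain C where C: "\<And>n k. k \<le> n \<Longrightarrow> real n * (cwalk (n - k) * cwalk k) \<le> C * sqrt (real n)"
    using cwalk_product_bound by blast
  have bound: "\<bar>h n k\<bar> \<le> (C + L) * sqrt (real n)" if "0 < n" "k \<le> n" for n k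
  proof -
    have "0 \<le> real n * (cwalk (n - k) * cwalk k)"
      by (intro mult_nonneg_nonneg cwalk_nonneg) auto
    moreover have "L \<le> L * sqrt (real n)"
      using L that mult_left_mono[of 1 "sqrt (real n)" L] by auto
    ultimately show ?thesis using C[OF that(2)] L unfolding h_def by (simp only: abs_le_iff distrib_right) linarith
  qed
  have cw: "(\<lambda>k. sqrt (real k) * cwalk k - of_bool True * c) \<longlonglongrightarrow> 0"
    using LIM_zero[OF cwalk_limit] by (simp add: c_def)
  have "((\<lambda>p. real (fst p) * (cwalk (fst p - snd p) * cwalk (snd p)) - of_bool True * (c\<^sup>2 / sqrt (x * (1 - x)))) \<longlongrightarrow> 0) (lln_filter x)"
    by (intro lln_filter_product x filterlim_compose[OF cw lln_filter_diff[OF x(2)]] filterlim_compose[OF cw lln_filter_snd[OF x(1)]])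
  then have "((\<lambda>(n, k). h n k) \<longlongrightarrow> 0) (lln_filter x)"
    by (simp add: case_prod_unfold h_def L_def)
  then have "(\<lambda>n. \<Sum>k\<le>n. Bernstein n k x * h n k) \<longlonglongrightarrow> 0"
    using x bound by (intro Bernstein_average_null[of _ _ "C + L"]) auto
  then have "Bseq (\<lambda>n. \<Sum>k\<le>n. Bernstein n k x * h n k)"
    by (intro convergent_imp_Bseq) (auto simp: convergent_def)
  then obtain K where K: "\<And>n. norm (\<Sum>k\<le>n. Bernstein n k x * h n k) \<le> K"
    unfolding Bseq_def by blast
  have "real n * (\<Sum>k\<le>n. Bernstein n k x * (walk (n - k) e * walk k d)) \<le> K + L" for n e d
  proof -
    have "(\<Sum>k\<le>n. Bernstein n k x * (walk (n - k) e * walk k d)) \<le> (\<Sum>k\<le>n. Bernstein n k x * (cwalk (n - k) * cwalk k))"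
      using x by (intro sum_mono mult_left_mono mult_mono walk_le_cwalk walk_nonneg cwalk_nonneg Bernstein_nonneg) auto
    then have "real n * (\<Sum>k\<le>n. Bernstein n k x * (walk (n - k) e * walk k d)) \<le> real n * (\<Sum>k\<le>n. Bernstein n k x * (cwalk (n - k) * cwalk k))"
      by (intro mult_left_mono) auto
    also have "\<dots> = (\<Sum>k\<le>n. Bernstein n k x * h n k + L * Bernstein n k x)"
      unfolding sum_distrib_left by (intro sum.cong refl) (simp add: h_def algebra_simps)
    also have "\<dots> = (\<Sum>k\<le>n. Bernstein n k x * h n k) + L"
      by (simp only: sum.distrib sum_distrib_left[symmetric] sum_Bernstein mult_1_right)
    finally show ?thesis using K[of n] by simp
  qed
  then show ?thesis by (rule that)
qed

subsection \<open>Two walks with a binomial number of steps\<close>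

text \<open>The tilted probability that a voters rank 1 above 3 and b voters rank 2 above 3: given k,
  the sum a + b is k plus twice a fair binomial variable on n - k voters, so a + b - n is a walk
  of n - k steps, and a - b is a walk of k steps.\<close>

definition walk_mix :: "real \<Rightarrow> nat \<Rightarrow> int \<Rightarrow> int \<Rightarrow> real" where
  "walk_mix x n a b = (\<Sum>k\<le>n. Bernstein n k x * (walk (n - k) (a + b - int n) * walk k (a - b)))"

text \<open>Conditions on the outcome of one further trial, by Pascal's rule.\<close>

lemma sum_Bernstein_Suc:
  "(\<Sum>k\<le>Suc n. Bernstein (Suc n) k x * f k)
    = (1 - x) * (\<Sum>k\<le>n. Bernstein n k x * f k) + x * (\<Sum>k\<le>n. Bernstein n k x * f (Suc k))"
proof -
  have B: "Bernstein (Suc n) (Suc k) x = x * Bernstein n k x + (1 - x) * Bernstein n (Suc k) x" for k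
  proof (cases "Suc k \<le> n")
    case True
    then have "n - k = Suc (n - Suc k)" by simp
    then show ?thesis by (simp add: Bernstein_def algebra_simps)
  next
    case False
    then have "n \<le> k" by simp
    then show ?thesis by (cases "k = n") (auto simp: Bernstein_def binomial_eq_0)
  qed
  have B0: "Bernstein (Suc n) 0 x = (1 - x) * Bernstein n 0 x"
    by (simp add: Bernstein_def)
  have top: "Bernstein n (Suc n) x = 0"
    by (simp add: Bernstein_def)
  have "(\<Sum>k\<le>Suc n. Bernstein (Suc n) k x * f k)
      = Bernstein (Suc n) 0 x * f 0 + (\<Sum>k\<le>n. Bernstein (Suc n) (Suc k) x * f (Suc k))"
    by (rule sum.atMost_Suc_shift)
  also have "\<dots> = (1 - x) * (Bernstein n 0 x * f 0 + (\<Sum>k\<le>n. Bernstein n (Suc k) x * f (Suc k)))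
      + x * (\<Sum>k\<le>n. Bernstein n k x * f (Suc k))"
    by (simp only: B B0 distrib_right sum.distrib mult.assoc sum_distrib_left distrib_left add_ac)
  also have "Bernstein n 0 x * f 0 + (\<Sum>k\<le>n. Bernstein n (Suc k) x * f (Suc k)) = (\<Sum>k\<le>Suc n. Bernstein n k x * f k)"
    by (rule sum.atMost_Suc_shift[symmetric])
  finally show ?thesis by (simp add: top)
qed

lemma walk_mix_0: "walk_mix x 0 a b = of_bool (a = 0 \<and> b = 0)"
  by (auto simp: walk_mix_def Bernstein_def)

text \<open>Conditions on one further voter: the first kind moves \<open>a + b - n\<close> by one
  and keeps \<open>a - b\<close>, the second kind does the opposite.\<close>

lemma walk_mix_Suc:
  "walk_mix x (Suc n) a b = (1 - x) / 2 * (walk_mix x n (a - 1) (b - 1) + walk_mix x n a b)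
     + x / 2 * (walk_mix x n (a - 1) b + walk_mix x n a (b - 1))"
proof -
  have 1: "Bernstein n k x * (walk (Suc n - k) (a + b - int (Suc n)) * walk k (a - b))
      = (Bernstein n k x * (walk (n - k) ((a - 1) + (b - 1) - int n) * walk k ((a - 1) - (b - 1)))
         + Bernstein n k x * (walk (n - k) (a + b - int n) * walk k (a - b))) / 2" if "k \<le> n" for k
  proof -
    have "Suc n - k = Suc (n - k)" using that by simp
    then have "walk (Suc n - k) (a + b - int (Suc n)) = (walk (n - k) ((a - 1) + (b - 1) - int n) + walk (n - k) (a + b - int n)) / 2"
      by (simp add: algebra_simps)
    then show ?thesis by (simp add: algebra_simps add_divide_distrib)
  qed
  have 2: "Bernstein n k x * (walk (Suc n - Suc k) (a + b - int (Suc n)) * walk (Suc k) (a - b))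
      = (Bernstein n k x * (walk (n - k) ((a - 1) + b - int n) * walk k ((a - 1) - b))
         + Bernstein n k x * (walk (n - k) (a + (b - 1) - int n) * walk k (a - (b - 1)))) / 2" for k
  proof -
    have "walk (Suc k) (a - b) = (walk k ((a - 1) - b) + walk k (a - (b - 1))) / 2"
      by (simp add: algebra_simps)
    moreover have "a + b - int (Suc n) = (a - 1) + b - int n" "a + b - int (Suc n) = a + (b - 1) - int n"
      by simp_all
    ultimately show ?thesis by (simp add: algebra_simps add_divide_distrib)
  qed
  have "walk_mix x (Suc n) a b
      = (1 - x) * (\<Sum>k\<le>n. Bernstein n k x * (walk (Suc n - k) (a + b - int (Suc n)) * walk k (a - b)))
      + x * (\<Sum>k\<le>n. Bernstein n k x * (walk (Suc n - Suc k) (a + b - int (Suc n)) * walk (Suc k) (a - b)))"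
    unfolding walk_mix_def by (rule sum_Bernstein_Suc)
  also have "(\<Sum>k\<le>n. Bernstein n k x * (walk (Suc n - k) (a + b - int (Suc n)) * walk k (a - b)))
      = (walk_mix x n (a - 1) (b - 1) + walk_mix x n a b) / 2"
    unfolding walk_mix_def sum.distrib[symmetric] sum_divide_distrib by (intro sum.cong refl 1) simp
  also have "(\<Sum>k\<le>n. Bernstein n k x * (walk (Suc n - Suc k) (a + b - int (Suc n)) * walk (Suc k) (a - b)))
      = (walk_mix x n (a - 1) b + walk_mix x n a (b - 1)) / 2"
    unfolding walk_mix_def sum.distrib[symmetric] sum_divide_distrib by (intro sum.cong refl 2)
  finally show ?thesis by simp
qed

subsection \<open>Rankings of three candidates\<close>

text \<open>Positions of candidates 1, 2, 3 as an explicit table, so that sums over rankings can be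
  computed; all other numbers are fixed, as \<open>permutes\<close> demands.\<close>

definition rank3 :: "nat \<Rightarrow> nat \<Rightarrow> nat \<Rightarrow> nat \<Rightarrow> nat" where
  "rank3 a b c x = (if x = 1 then a else if x = 2 then b else if x = 3 then c else x)"

lemma rank3_simps [simp]: "rank3 a b c 1 = a" "rank3 a b c (Suc 0) = a" "rank3 a b c 2 = b" "rank3 a b c 3 = c"
  by (simp_all add: rank3_def)

lemma rank3_inject [simp]: "rank3 a b c = rank3 a' b' c' \<longleftrightarrow> a = a' \<and> b = b' \<and> c = c'"
  by (metis rank3_simps)

lemma rankings_eq:
  "rankings = {rank3 1 2 3, rank3 1 3 2, rank3 2 1 3, rank3 2 3 1, rank3 3 1 2, rank3 3 2 1}"
proof (intro equalityI subsetI)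
  fix \<sigma> assume "\<sigma> \<in> rankings"
  then have p: "\<sigma> permutes {1,2,3}" by (simp add: rankings_def)
  have eq: "\<sigma> = rank3 (\<sigma> 1) (\<sigma> 2) (\<sigma> 3)"
    using permutes_not_in[OF p] by (auto simp: rank3_def)
  have "\<sigma> 1 \<in> {1,2,3}" "\<sigma> 2 \<in> {1,2,3}" "\<sigma> 3 \<in> {1,2,3}"
    by (simp_all only: permutes_in_image[OF p]) simp_all
  moreover have "\<sigma> 1 \<noteq> \<sigma> 2" "\<sigma> 1 \<noteq> \<sigma> 3" "\<sigma> 2 \<noteq> \<sigma> 3"
    by (simp_all add: inj_eq[OF permutes_inj[OF p]])
  ultimately have *: "rank3 (\<sigma> 1) (\<sigma> 2) (\<sigma> 3) \<in> {rank3 1 2 3, rank3 1 3 2, rank3 2 1 3, rank3 2 3 1, rank3 3 1 2, rank3 3 2 1}"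
    unfolding insert_iff rank3_inject by (elim disjE emptyE) simp_all
  show "\<sigma> \<in> {rank3 1 2 3, rank3 1 3 2, rank3 2 1 3, rank3 2 3 1, rank3 3 1 2, rank3 3 2 1}"
    by (subst eq) (rule *)
next
  have perm: "rank3 a b c permutes {1,2,3}" if "{a, b, c} = {1,2,3}" for a b c
  proof (rule bij_imp_permutes)
    have "rank3 a b c ` {1,2,3} = {1,2,3}" using that by simp
    moreover from this have "inj_on (rank3 a b c) {1,2,3}"
      by (intro eq_card_imp_inj_on) simp_all
    ultimately show "bij_betw (rank3 a b c) {1,2,3} {1,2,3}" by (simp add: bij_betw_def)
  qed (simp add: rank3_def)
  have "rank3 1 2 3 permutes {1,2,3}" "rank3 1 3 2 permutes {1,2,3}" "rank3 2 1 3 permutes {1,2,3}"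
    "rank3 2 3 1 permutes {1,2,3}" "rank3 3 1 2 permutes {1,2,3}" "rank3 3 2 1 permutes {1,2,3}"
    by (rule perm, (auto)[1])+
  then have "{rank3 1 2 3, rank3 1 3 2, rank3 2 1 3, rank3 2 3 1, rank3 3 1 2, rank3 3 2 1} \<subseteq> rankings"
    by (simp only: insert_subset empty_subsetI rankings_def mem_Collect_eq simp_thms)
  then show "\<sigma> \<in> rankings" if "\<sigma> \<in> {rank3 1 2 3, rank3 1 3 2, rank3 2 1 3, rank3 2 3 1, rank3 3 1 2, rank3 3 2 1}" for \<sigma>
    using that by (rule subsetD)
qed

lemma sum_rankings:
  "(\<Sum>\<sigma>\<in>rankings. f \<sigma>) = f (rank3 1 2 3) + f (rank3 1 3 2) + f (rank3 2 1 3)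
     + f (rank3 2 3 1) + f (rank3 3 1 2) + (f (rank3 3 2 1) :: 'a :: comm_monoid_add)"
  by (simp add: rankings_eq add_ac)

lemma above_3_iff: "\<sigma> \<in> rankings \<Longrightarrow> j \<in> {1, 2} \<Longrightarrow> above \<sigma> 3 j \<longleftrightarrow> \<not> above \<sigma> j 3"
  by (auto simp: rankings_eq above_def)

lemma kendall_ref_eq:
  "kendall_ref \<sigma> = of_bool (\<sigma> 2 < \<sigma> 1) + of_bool (\<sigma> 3 < \<sigma> 1) + of_bool (\<sigma> 3 < \<sigma> 2)"
proof -
  have "{(a,b). a \<in> {1,2,3} \<and> b \<in> {1,2,3} \<and> a < b \<and> above \<sigma> b a}
      = (if \<sigma> 2 < \<sigma> 1 then {(1,2)} else {}) \<union> (if \<sigma> 3 < \<sigma> 1 then {(1,3)} else {}) \<union> (if \<sigma> 3 < \<sigma> 2 then {(2,3)} else {})"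
    by (auto simp: above_def split: if_splits)
  then show ?thesis by (simp add: kendall_ref_def)
qed

lemma kendall_ref_rank3:
  "kendall_ref (rank3 1 2 3) = 0" "kendall_ref (rank3 1 3 2) = 1" "kendall_ref (rank3 2 1 3) = 1"
  "kendall_ref (rank3 2 3 1) = 2" "kendall_ref (rank3 3 1 2) = 2" "kendall_ref (rank3 3 2 1) = 3"
  by (simp_all add: kendall_ref_eq)

subsection \<open>Hessian of the logarithm of a bilinear polynomial\<close>

text \<open>The normalised terms of the polynomial form a probability law on pairs of bits, and the
  Hessian of its logarithm is the covariance matrix of that law.\<close>

lemma det2_hessian_ln_bilinear:
  fixes a b c d :: real
  assumes pos: "a > 0" "b > 0" "c > 0" "d > 0"
    and f: "f = (\<lambda>t. ln (a + b * exp (t 1) + c * exp (t 2) + d * (exp (t 1) * exp (t 2))))"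
    and xy: "x = exp (u 1)" "y = exp (u 2)"
  shows "det2_hessian f u = x * y * ((a + c * y) * (b + d * y) * (a + b * x) * (c + d * x) - x * y * (a * d - b * c)\<^sup>2)
           / (a + b * x + c * y + d * (x * y)) ^ 4"
proof -
  have N: "a + b * exp p + c * exp q + d * (exp p * exp q) > 0" for p q
    using pos by (simp add: add_pos_pos)
  note N' = less_imp_neq[OF N, symmetric]
  have 1: "pderiv_i f 1 = (\<lambda>t. (b * exp (t 1) + d * (exp (t 1) * exp (t 2))) / (a + b * exp (t 1) + c * exp (t 2) + d * (exp (t 1) * exp (t 2))))"
  proof
    fix t
    show "pderiv_i f 1 t = (b * exp (t 1) + d * (exp (t 1) * exp (t 2))) / (a + b * exp (t 1) + c * exp (t 2) + d * (exp (t 1) * exp (t 2)))"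
      unfolding pderiv_i_def f
      by (rule DERIV_imp_deriv) (use N in \<open>auto intro!: derivative_eq_intros simp: divide_inverse\<close>)
  qed
  have 2: "pderiv_i f 2 = (\<lambda>t. (c * exp (t 2) + d * (exp (t 1) * exp (t 2))) / (a + b * exp (t 1) + c * exp (t 2) + d * (exp (t 1) * exp (t 2))))"
  proof
    fix t
    show "pderiv_i f 2 t = (c * exp (t 2) + d * (exp (t 1) * exp (t 2))) / (a + b * exp (t 1) + c * exp (t 2) + d * (exp (t 1) * exp (t 2)))"
      unfolding pderiv_i_def f
      by (rule DERIV_imp_deriv) (use N in \<open>auto intro!: derivative_eq_intros simp: divide_inverse\<close>)
  qed
  define M where "M = a + b * x + c * y + d * (x * y)"
  have M: "M > 0" using N[of "u 1" "u 2"] by (simp add: M_def xy)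
  \<comment> \<open>Since \<open>x * (b + d * y)\<close> and \<open>a + c * y\<close> sum to
    \<open>M\<close>, this is a Bernoulli variance \<open>p * (1 - p)\<close>.\<close>
  have 11: "hessian f 1 1 u = (x * (b + d * y) * (a + c * y)) / M\<^sup>2"
    unfolding hessian_def 1 pderiv_i_def
    by (rule DERIV_imp_deriv, (rule derivative_eq_intros refl N' | simp)+)
      (simp add: xy M_def power2_eq_square algebra_simps)
  have 22: "hessian f 2 2 u = (y * (c + d * x) * (a + b * x)) / M\<^sup>2"
    unfolding hessian_def 2 pderiv_i_def
    by (rule DERIV_imp_deriv, (rule derivative_eq_intros refl N' | simp)+)
      (simp add: xy M_def power2_eq_square algebra_simps)
  \<comment> \<open>The covariance of the two bits, which vanishes exactly when
    \<open>a * d = b * c\<close>.\<close>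
  have 12: "hessian f 1 2 u = (x * y * (a * d - b * c)) / M\<^sup>2"
    unfolding hessian_def 2 pderiv_i_def
    by (rule DERIV_imp_deriv, (rule derivative_eq_intros refl N' | simp)+)
      (simp add: xy M_def power2_eq_square algebra_simps)
  have 21: "hessian f 2 1 u = (x * y * (a * d - b * c)) / M\<^sup>2"
    unfolding hessian_def 1 pderiv_i_def
    by (rule DERIV_imp_deriv, (rule derivative_eq_intros refl N' | simp)+)
      (simp add: xy M_def power2_eq_square algebra_simps)
  have "M\<^sup>2 * M\<^sup>2 = M ^ 4" by simp
  then show ?thesis
    unfolding det2_hessian_def 11 22 12 21 M_def[symmetric] times_divide_times_eq diff_divide_distrib[symmetric]
    by (simp add: power2_eq_square algebra_simps)
qed

subsection \<open>Joint law of the two majority counts\<close>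

text \<open>Counts are integers so that the recursion over voters can subtract 1 without truncation
  at 0.\<close>

definition count_prob :: "real \<Rightarrow> nat \<Rightarrow> int \<Rightarrow> int \<Rightarrow> real" where
  "count_prob \<rho> n a b = (\<Sum>p\<in>(PiE {..<n} (\<lambda>_. rankings)). (\<Prod>i<n. mallows \<rho> (p i)) *
     of_bool (int (card {i\<in>{..<n}. above (p i) 1 3}) = a \<and> int (card {i\<in>{..<n}. above (p i) 2 3}) = b))"

lemma sum_PiE_lessThan_Suc:
  "(\<Sum>p\<in>PiE {..<Suc n} (\<lambda>_. R). F p) = (\<Sum>y\<in>R. \<Sum>g\<in>PiE {..<n} (\<lambda>_. R). F (g(n := y)))"
  unfolding lessThan_Suc PiE_insert_eq sum.cartesian_product
  by (subst sum.reindex[OF inj_combinator]) (simp_all add: case_prod_unfold)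

lemma card_fun_upd_lessThan_Suc:
  "card {i\<in>{..<Suc n}. Q ((g(n := y)) i)} = card {i\<in>{..<n}. Q (g i)} + of_bool (Q y)"
proof -
  have "{i\<in>{..<Suc n}. Q ((g(n := y)) i)} = {i\<in>{..<n}. Q (g i)} \<union> (if Q y then {n} else {})"
    by (auto simp: less_Suc_eq)
  then show ?thesis by auto
qed

lemma count_prob_0: "count_prob \<rho> 0 a b = of_bool (a = 0 \<and> b = 0)"
  by (auto simp: count_prob_def)

lemma count_prob_Suc:
  "count_prob \<rho> (Suc n) a b
    = (\<Sum>\<sigma>\<in>rankings. mallows \<rho> \<sigma> * count_prob \<rho> n (a - of_bool (above \<sigma> 1 3)) (b - of_bool (above \<sigma> 2 3)))"
proof -
  have *: "(\<Prod>i<Suc n. mallows \<rho> ((g(n := y)) i)) = mallows \<rho> y * (\<Prod>i<n. mallows \<rho> (g i))" for g y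
    by (simp add: mult.commute)
  show ?thesis
    unfolding count_prob_def sum_PiE_lessThan_Suc card_fun_upd_lessThan_Suc[where Q = "\<lambda>\<sigma>. above \<sigma> 1 3"]
      card_fun_upd_lessThan_Suc[where Q = "\<lambda>\<sigma>. above \<sigma> 2 3"] * sum_distrib_left mult.assoc
    by (intro sum.cong refl) (auto simp: algebra_simps)
qed

text \<open>Preferences are strict, so if \<open>A\<close> voters put \<open>j\<close> above 3, the
  other \<open>n - A\<close> put 3 above \<open>j\<close>. A strict majority then means
  \<open>2 * A < n\<close>, that is \<open>A \<le> (n - 1) div 2\<close> for positive
  \<open>n\<close>.\<close>

lemma prob_cw3_eq:
  assumes n: "0 < n"
  shows "prob_cw3 \<rho> n = (\<Sum>a\<le>(n - 1) div 2. \<Sum>b\<le>(n - 1) div 2. count_prob \<rho> n (int a) (int b))"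
proof -
  let ?m = "(n - 1) div 2"
  define A where "A p j = card {i\<in>{..<n}. above (p i) j 3}" for p :: "nat \<Rightarrow> nat \<Rightarrow> nat" and j
  have cw: "(2 * card {i\<in>{..<n}. above (p i) 3 j} > n) \<longleftrightarrow> A p j \<le> ?m" if p: "p \<in> PiE {..<n} (\<lambda>_. rankings)" and j: "j \<in> {1, 2}" for p j
  proof -
    have "{i\<in>{..<n}. above (p i) 3 j} = {..<n} - {i\<in>{..<n}. above (p i) j 3}"
      using above_3_iff[OF PiE_mem[OF p] j] by auto
    moreover have "A p j \<le> card {..<n}"
      unfolding A_def by (intro card_mono) auto
    ultimately have "card {i\<in>{..<n}. above (p i) 3 j} + A p j = n"
      unfolding A_def by (subst \<open>{i\<in>{..<n}. above (p i) 3 j} = _\<close>, subst card_Diff_subset) auto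
    then show ?thesis using n by linarith
  qed
  \<comment> \<open>Point masses replace the indicator of the quadrant, after which the sums can be
    interchanged.\<close>
  have dbl: "(\<Sum>a\<le>m. \<Sum>b\<le>m. of_bool (int A = int a \<and> int B = int b)) = (of_bool (A \<le> m \<and> B \<le> m) :: real)" for A B m :: nat
  proof -
    have "(\<Sum>a\<le>m. \<Sum>b\<le>m. of_bool (int A = int a \<and> int B = int b)) = (\<Sum>a\<le>m. \<Sum>b\<le>m. (of_bool (a = A) * of_bool (b = B) :: real))"
      by (intro sum.cong refl) auto
    then show ?thesis by (simp add: sum_distrib_left[symmetric] sum_distrib_right[symmetric] of_bool_def)
  qed
  have "prob_cw3 \<rho> n = (\<Sum>p\<in>PiE {..<n} (\<lambda>_. rankings). (\<Prod>i<n. mallows \<rho> (p i)) * of_bool (A p 1 \<le> ?m \<and> A p 2 \<le> ?m))"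
    unfolding prob_cw3_def
  proof (intro sum.cong refl arg_cong2[where f = "(*)"])
    fix p assume p: "p \<in> PiE {..<n} (\<lambda>_. rankings)"
    show "(if \<forall>j\<in>{1,2}. 2 * card {i\<in>{..<n}. above (p i) 3 j} > n then 1 else 0 :: real) = of_bool (A p 1 \<le> ?m \<and> A p 2 \<le> ?m)"
      using cw[OF p, of 1] cw[OF p, of 2] by simp
  qed
  also have "\<dots> = (\<Sum>p\<in>PiE {..<n} (\<lambda>_. rankings). \<Sum>a\<le>?m. \<Sum>b\<le>?m. (\<Prod>i<n. mallows \<rho> (p i)) *
      of_bool (int (A p 1) = int a \<and> int (A p 2) = int b))"
    by (simp only: dbl[symmetric] sum_distrib_left)
  also have "\<dots> = (\<Sum>a\<le>?m. \<Sum>b\<le>?m. \<Sum>p\<in>PiE {..<n} (\<lambda>_. rankings). (\<Prod>i<n. mallows \<rho> (p i)) *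
      of_bool (int (A p 1) = int a \<and> int (A p 2) = int b))"
    by (subst sum.swap, intro sum.cong refl, rule sum.swap)
  finally show ?thesis by (simp only: count_prob_def A_def)
qed

section \<open>Dominated convergence for geometrically weighted sums\<close>

text \<open>Tannery's theorem, first for the inner series with majorant \<open>y ^ j * M\<close>,
  then for the outer one with \<open>x ^ i * (M / (1 - y))\<close>.\<close>

lemma double_geometric_tannery:
  fixes g :: "nat \<Rightarrow> nat \<Rightarrow> nat \<Rightarrow> real"
  assumes x: "0 \<le> x" "x < 1" and y: "0 \<le> y" "y < 1"
    and bound: "\<And>n i j. \<bar>g n i j\<bar> \<le> M"
    and lim: "\<And>i j. (\<lambda>n. g n i j) \<longlonglongrightarrow> L"
  shows "(\<lambda>n. \<Sum>i. x ^ i * (\<Sum>j. y ^ j * g n i j)) \<longlonglongrightarrow> L / ((1 - x) * (1 - y))"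
proof -
  have M: "0 \<le> M" using bound[of 0 0 0] by linarith
  have sx: "summable (\<lambda>i. x ^ i)" and sy: "summable (\<lambda>j. y ^ j)"
    using x y by (auto intro: summable_geometric)
  have sMy: "summable (\<lambda>j. y ^ j * M)" using sy by (rule summable_mult2)
  have le: "norm (y ^ j * g n i j) \<le> y ^ j * M" for n i j
    using bound[of n i j] y by (simp add: abs_mult mult_left_mono)
  have inner: "(\<lambda>n. \<Sum>j. y ^ j * g n i j) \<longlonglongrightarrow> L / (1 - y)" for i
  proof -
    have "(\<lambda>n. \<Sum>j. y ^ j * g n i j) \<longlonglongrightarrow> (\<Sum>j. y ^ j * L)"
      by (rule tannerys_theorem[THEN conjunct2, THEN conjunct2, OF _ _ sMy])
        (use le in \<open>auto intro!: tendsto_intros lim always_eventually\<close>)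
    also have "(\<Sum>j. y ^ j * L) = L / (1 - y)"
      using suminf_mult2[OF sy, of L] suminf_geometric[of y] y by simp
    finally show ?thesis .
  qed
  have inner_le: "\<bar>\<Sum>j. y ^ j * g n i j\<bar> \<le> M / (1 - y)" for n i
  proof -
    have "norm (\<Sum>j. y ^ j * g n i j) \<le> (\<Sum>j. y ^ j * M)"
      by (rule norm_suminf_le[OF le sMy])
    also have "\<dots> = M / (1 - y)"
      using suminf_mult2[OF sy, of M] suminf_geometric[of y] y by simp
    finally show ?thesis by simp
  qed
  have "(\<lambda>n. \<Sum>i. x ^ i * (\<Sum>j. y ^ j * g n i j)) \<longlonglongrightarrow> (\<Sum>i. x ^ i * (L / (1 - y)))"
  proof (rule tannerys_theorem[THEN conjunct2, THEN conjunct2])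
    show "summable (\<lambda>i. x ^ i * (M / (1 - y)))" using sx by (rule summable_mult2)
    have "x ^ i * \<bar>\<Sum>j. y ^ j * g n i j\<bar> \<le> x ^ i * (M / (1 - y))" for i n
      using x by (intro mult_left_mono inner_le) auto
    then show "\<forall>\<^sub>F (i, n) in at_top \<times>\<^sub>F sequentially. norm (x ^ i * (\<Sum>j. y ^ j * g n i j)) \<le> x ^ i * (M / (1 - y))"
      using x by (auto intro!: always_eventually simp: abs_mult)
    show "(\<lambda>n. x ^ i * (\<Sum>j. y ^ j * g n i j)) \<longlonglongrightarrow> x ^ i * (L / (1 - y))" for i
      by (rule tendsto_mult_left[OF inner])
  qed simp
  also have "(\<Sum>i. x ^ i * (L / (1 - y))) = L / ((1 - x) * (1 - y))"
    using suminf_mult2[OF sx, of "L / (1 - y)"] suminf_geometric[of x] x by simp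
  finally show ?thesis .
qed

text \<open>Identifies the exponent in the asymptotic formula with the largest count compatible with
  a win of 3. At \<open>n = 0\<close> truncated subtraction makes both sides 0.\<close>

lemma nat_ceiling_half: "nat \<lceil>real n / 2\<rceil> - 1 = (n - 1) div 2"
proof (cases "even n")
  case True
  then obtain k where k: "n = 2 * k" by (elim evenE)
  then have "real n / 2 = real k" by simp
  then have "nat \<lceil>real n / 2\<rceil> = k" by (simp only: ceiling_of_nat nat_int)
  moreover have "k - 1 = (2 * k - 1) div 2" by (cases k) auto
  ultimately show ?thesis using k by (simp only:)
next
  case False
  then obtain k where k: "n = 2 * k + 1" by (elim oddE)
  then have "\<lceil>real n / 2\<rceil> = int k + 1" by (intro ceiling_unique) (auto simp: field_simps)
  then have "nat \<lceil>real n / 2\<rceil> = k + 1" by simp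
  then show ?thesis using k by simp
qed

lemma walk_mix_limit:
  assumes x: "0 < x" "x < 1"
  shows "(\<lambda>n. real n * walk_mix x n (int ((n - 1) div 2) - int i) (int ((n - 1) div 2) - int j))
           \<longlonglongrightarrow> 1 / (pi * sqrt (x * (1 - x)))"
proof -
  \<comment> \<open>With \<open>m = (n - 1) div 2\<close>, the number \<open>2 * m - n\<close> is -2
    for even and -1 for odd \<open>n > 0\<close>; hence two offsets.\<close>
  define e0 e1 d :: int where "e0 = - 2 - int i - int j" and "e1 = - 1 - int i - int j" and "d = int j - int i"
  have "even (int n + (if even n then e0 else e1) + d)" for n
    by (auto simp: e0_def e1_def d_def)
  from walk_convolution_limit[OF x this]
  have lim: "(\<lambda>n. real n * (\<Sum>k\<le>n. Bernstein n k x * (walk (n - k) (if even n then e0 else e1) * walk k d)))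
    \<longlonglongrightarrow> 1 / (pi * sqrt (x * (1 - x)))" .
  show ?thesis
  proof (rule Lim_transform_eventually[OF lim])
    show "\<forall>\<^sub>F n in sequentially. real n * (\<Sum>k\<le>n. Bernstein n k x * (walk (n - k) (if even n then e0 else e1) * walk k d))
      = real n * walk_mix x n (int ((n - 1) div 2) - int i) (int ((n - 1) div 2) - int j)"
      using eventually_gt_at_top[of 0]
    proof eventually_elim
      case (elim n)
      then obtain k where "n = Suc k" by (auto simp: gr0_conv_Suc)
      then have "2 * int ((n - 1) div 2) - int n = (if even n then - 2 else - 1)"
        by (simp add: zdiv_int) presburger
      then have "int ((n - 1) div 2) - int i + (int ((n - 1) div 2) - int j) - int n = (if even n then e0 else e1)"
        by (auto simp: e0_def e1_def)
      moreover have "int ((n - 1) div 2) - int i - (int ((n - 1) div 2) - int j) = d"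
        by (simp add: d_def)
      ultimately show ?case by (simp only: walk_mix_def)
    qed
  qed
qed

lemma geometric_walk_mix_sum_limit:
  assumes x: "0 < x" "x < 1" and y: "0 \<le> y" "y < 1" and z: "0 \<le> z" "z < 1"
  shows "(\<lambda>n. real n * (\<Sum>i\<le>(n - 1) div 2. \<Sum>j\<le>(n - 1) div 2. y ^ i * z ^ j *
            walk_mix x n (int ((n - 1) div 2) - int i) (int ((n - 1) div 2) - int j)))
           \<longlonglongrightarrow> 1 / (pi * sqrt (x * (1 - x))) / ((1 - y) * (1 - z))"
proof -
  define W where "W n i j = real n * walk_mix x n (int ((n - 1) div 2) - int i) (int ((n - 1) div 2) - int j)" for n i j
  \<comment> \<open>The indicator extends the finite sums to full series, and for fixed
    \<open>i\<close> and \<open>j\<close> it is eventually 1.\<close>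
  define g where "g n i j = of_bool (i \<le> (n - 1) div 2 \<and> j \<le> (n - 1) div 2) * W n i j" for n i j
  obtain M where M: "\<And>n d e. real n * (\<Sum>k\<le>n. Bernstein n k x * (walk (n - k) e * walk k d)) \<le> M"
    using walk_convolution_bounded[OF x] by blast
  have "0 \<le> walk_mix x n a b" for n a b
    unfolding walk_mix_def using x by (intro sum_nonneg mult_nonneg_nonneg Bernstein_nonneg walk_nonneg) auto
  moreover have "real n * walk_mix x n a b \<le> M" for n a b
    unfolding walk_mix_def by (rule M)
  ultimately have W: "0 \<le> W n i j" "W n i j \<le> M" for n i j
    unfolding W_def by simp_all
  have "(\<lambda>n. \<Sum>i. y ^ i * (\<Sum>j. z ^ j * g n i j)) \<longlonglongrightarrow> 1 / (pi * sqrt (x * (1 - x))) / ((1 - y) * (1 - z))"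
  proof (rule double_geometric_tannery[OF y z])
    have "0 \<le> M" using W[of 0 0 0] by linarith
    then show "\<bar>g n i j\<bar> \<le> M" for n i j using W[of n i j] by (simp add: g_def)
    show "(\<lambda>n. g n i j) \<longlonglongrightarrow> 1 / (pi * sqrt (x * (1 - x)))" for i j
    proof (rule Lim_transform_eventually[OF walk_mix_limit[OF x, of i j]])
      show "\<forall>\<^sub>F n in sequentially. real n * walk_mix x n (int ((n - 1) div 2) - int i) (int ((n - 1) div 2) - int j) = g n i j"
        using eventually_ge_at_top[of "2 * i + 2 * j + 1"] by eventually_elim (auto simp: g_def W_def)
    qed
  qed
  moreover have "(\<Sum>i. y ^ i * (\<Sum>j. z ^ j * g n i j)) = real n * (\<Sum>i\<le>(n - 1) div 2. \<Sum>j\<le>(n - 1) div 2. y ^ i * z ^ j *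
            walk_mix x n (int ((n - 1) div 2) - int i) (int ((n - 1) div 2) - int j))" for n
  proof -
    let ?m = "(n - 1) div 2"
    have "(\<Sum>j. z ^ j * g n i j) = (\<Sum>j\<le>?m. z ^ j * g n i j)" for i
      by (rule suminf_finite) (auto simp: g_def)
    moreover have "(\<Sum>i. y ^ i * (\<Sum>j\<le>?m. z ^ j * g n i j)) = (\<Sum>i\<le>?m. y ^ i * (\<Sum>j\<le>?m. z ^ j * g n i j))"
      by (rule suminf_finite) (auto simp: g_def)
    ultimately have "(\<Sum>i. y ^ i * (\<Sum>j. z ^ j * g n i j)) = (\<Sum>i\<le>?m. y ^ i * (\<Sum>j\<le>?m. z ^ j * g n i j))"
      by (simp only:)
    also have "\<dots> = real n * (\<Sum>i\<le>?m. \<Sum>j\<le>?m. y ^ i * z ^ j * walk_mix x n (int ?m - int i) (int ?m - int j))"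
      unfolding sum_distrib_left by (intro sum.cong refl) (auto simp: g_def W_def mult_ac)
    finally show ?thesis .
  qed
  ultimately show ?thesis by (simp only:)
qed

subsection \<open>Asymptotics under the Mallows culture\<close>

text \<open>In terms of \<open>s\<close> everything is rational: \<open>zeta\<close> is
  \<open>(s^3, s)\<close> and each discordant pair costs \<open>s^2\<close>. \<open>Z\<close> is the
  Mallows normaliser, and \<open>x\<close> is the tilted probability that exactly one of 1 and 2 is
  above 3.\<close>

context
  fixes \<rho> s Z x :: real
  assumes \<rho>: "\<rho> > 0"
  defines "s \<equiv> exp (- \<rho> / 2)"
  defines "Z \<equiv> (1 + s ^ 2) * (1 + s ^ 2 + s ^ 4)"
  defines "x \<equiv> s / (1 + s + s ^ 2)"
begin

lemma s_bounds: "0 < s" "s < 1"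
  using \<rho> by (simp_all add: s_def)

lemma Z_pos: "0 < Z"
  by (simp add: Z_def add_pos_nonneg)

lemma exp_weight: "exp (- \<rho> * real k) = (s ^ 2) ^ k"
proof -
  have "exp (- \<rho> * real k) = exp (real (2 * k) * (- \<rho> / 2))" by simp
  then show ?thesis by (simp only: s_def exp_of_nat_mult power_mult)
qed

lemma mallows_eq: "mallows \<rho> \<sigma> = (s ^ 2) ^ kendall_ref \<sigma> / Z"
proof -
  have "(\<Sum>\<tau>\<in>rankings. exp (- \<rho> * real (kendall_ref \<tau>))) = Z"
    unfolding exp_weight sum_rankings kendall_ref_rank3 power_mult[symmetric]
    by (simp add: Z_def) (simp add: algebra_simps eval_nat_numeral)
  then show ?thesis by (simp only: mallows_def exp_weight[symmetric])
qed

text \<open>The six rankings fall into four classes by the positions of 1 and 2 relative to 3; this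
  gives both the polynomial and the recursion over voters.\<close>

lemma sum_mallows:
  "(\<Sum>\<sigma>\<in>rankings. mallows \<rho> \<sigma> * f (above \<sigma> 1 3) (above \<sigma> 2 3))
    = ((1 + s ^ 2) * f True True + s ^ 2 * f True False + s ^ 4 * f False True + (s ^ 4 + s ^ 6) * f False False) / Z"
proof -
  have "mallows \<rho> (rank3 1 2 3) = 1 / Z" "mallows \<rho> (rank3 1 3 2) = s ^ 2 / Z"
    "mallows \<rho> (rank3 2 1 3) = s ^ 2 / Z" "mallows \<rho> (rank3 2 3 1) = s ^ 4 / Z"
    "mallows \<rho> (rank3 3 1 2) = s ^ 4 / Z" "mallows \<rho> (rank3 3 2 1) = s ^ 6 / Z"
    by (simp_all only: mallows_eq kendall_ref_rank3 power_mult[symmetric]) simp_all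
  then show ?thesis
    unfolding sum_rankings by (simp add: above_def add_divide_distrib distrib_right)
qed

lemma pX_eq:
  assumes "X \<subseteq> {1, 2}"
  shows "pX \<rho> X = ((1 + s ^ 2) * of_bool (1 \<in> X \<and> 2 \<in> X) + s ^ 2 * of_bool (1 \<in> X \<and> 2 \<notin> X)
     + s ^ 4 * of_bool (1 \<notin> X \<and> 2 \<in> X) + (s ^ 4 + s ^ 6) * of_bool (1 \<notin> X \<and> 2 \<notin> X)) / Z"
proof -
  have fin: "finite rankings" by (simp add: rankings_eq)
  have "({j \<in> {1, 2}. above \<sigma> j 3} = X) \<longleftrightarrow> (above \<sigma> 1 3 \<longleftrightarrow> 1 \<in> X) \<and> (above \<sigma> 2 3 \<longleftrightarrow> 2 \<in> X)" for \<sigma>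
    using assms by auto
  then have "pX \<rho> X = (\<Sum>\<sigma>\<in>rankings. mallows \<rho> \<sigma> * of_bool ((above \<sigma> 1 3 \<longleftrightarrow> 1 \<in> X) \<and> (above \<sigma> 2 3 \<longleftrightarrow> 2 \<in> X)))"
    unfolding pX_def sum.inter_filter[OF fin] by (intro sum.cong refl) auto
  also note sum_mallows[of "\<lambda>u v. of_bool ((u \<longleftrightarrow> 1 \<in> X) \<and> (v \<longleftrightarrow> 2 \<in> X))"]
  finally show ?thesis by simp
qed

lemma Ppoly_eq:
  "Ppoly \<rho> v = ((s ^ 4 + s ^ 6) + s ^ 2 * v 1 + s ^ 4 * v 2 + (1 + s ^ 2) * (v 1 * v 2)) / Z"
proof -
  have P: "Pow {1, 2 :: nat} = {{}, {1}, {2}, {1, 2}}" by auto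
  have "{1 :: nat} \<noteq> {2}" "{1 :: nat} \<noteq> {1, 2}" "{2 :: nat} \<noteq> {1, 2}" by auto
  then show ?thesis
    unfolding Ppoly_def P by (simp add: pX_eq add_divide_distrib algebra_simps)
qed

lemma zeta_eq: "zeta \<rho> 1 = s ^ 3" "zeta \<rho> 2 = s"
  by (simp_all add: zeta_def s_def exp_of_nat_mult[symmetric])

text \<open>Up to the factor \<open>1 / Z\<close>, the terms for none and for both above 3 are
  \<open>s^4 + s^6\<close> each, and the two for exactly one are \<open>s^5\<close> each. This
  symmetry puts both tilted means at 1/2, the majority threshold.\<close>

lemma Ppoly_zeta: "Ppoly \<rho> (zeta \<rho>) = 2 * s ^ 4 * (1 + s + s ^ 2) / Z"
  by (simp add: Ppoly_eq zeta_eq zeta_eq(1)[simplified] add_divide_distrib[symmetric]) (simp add: algebra_simps eval_nat_numeral)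

lemma x_bounds: "0 < x" "x < 1"
  using s_bounds by (simp_all add: x_def add_pos_pos)

lemma one_minus_x: "1 - x = (1 + s ^ 2) / (1 + s + s ^ 2)"
proof -
  have "1 + s + s ^ 2 > 0" using s_bounds by (simp add: add_pos_pos)
  then show ?thesis by (simp add: x_def field_simps)
qed

text \<open>Change of measure: the power of \<open>s\<close> undoes the tilt by \<open>zeta\<close>,
  being the product of its components to the powers \<open>-a\<close> and \<open>-b\<close>. Integer
  exponents admit the negative arguments met in the induction.\<close>

lemma count_prob_eq:
  "count_prob \<rho> n a b = Ppoly \<rho> (zeta \<rho>) ^ n * s powi (- (3 * a + b)) * walk_mix x n a b"
proof (induction n arbitrary: a b)
  case 0
  show ?case by (auto simp: count_prob_0 walk_mix_0)
next
  case (Suc n)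
  define P where "P = Ppoly \<rho> (zeta \<rho>)"
  define e where "e = s powi (- (3 * a + b))"
  have s: "s \<noteq> 0" using s_bounds by simp
  have Z: "Z \<noteq> 0" using Z_pos by simp
  have S: "1 + s + s ^ 2 \<noteq> 0" using s_bounds by (simp add: add_pos_pos less_imp_neq[symmetric])
  have e11: "s powi (- (3 * (a - 1) + (b - 1))) = e * s ^ 4"
    unfolding e_def power_int_numeral[symmetric] by (subst power_int_add[symmetric]) (use s in \<open>auto simp: algebra_simps\<close>)
  have e10: "s powi (- (3 * (a - 1) + b)) = e * s ^ 3"
    unfolding e_def power_int_numeral[symmetric] by (subst power_int_add[symmetric]) (use s in \<open>auto simp: algebra_simps\<close>)
  have e01: "s powi (- (3 * a + (b - 1))) = e * s"
  proof -
    have "s powi (- (3 * a + (b - 1))) = s powi (- (3 * a + b) + 1)" by (simp add: algebra_simps)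
    then show ?thesis using s by (simp add: power_int_add e_def)
  qed
  have P: "P = 2 * s ^ 4 * (1 + s + s ^ 2) / Z" by (simp add: P_def Ppoly_zeta)
  define w where "w = 1 + s + s ^ 2"
  have w: "w \<noteq> 0" using S by (simp add: w_def)
  \<comment> \<open>\<open>p0\<close> and \<open>p1\<close> match the step probabilities
    \<open>(1 - x) / 2\<close> and \<open>x / 2\<close> with the tilted weights of one
    voter.\<close>
  then have p0: "P * ((1 - x) / 2) = s ^ 4 * (1 + s ^ 2) / Z"
    unfolding P one_minus_x w_def[symmetric] by simp
  have p1: "P * (x / 2) = s ^ 5 / Z"
    unfolding P x_def w_def[symmetric] using w by (simp add: eval_nat_numeral)
  define w11 w10 w01 w00 where "w11 = walk_mix x n (a - 1) (b - 1)" and "w10 = walk_mix x n (a - 1) b"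
    and "w01 = walk_mix x n a (b - 1)" and "w00 = walk_mix x n a b"
  have "count_prob \<rho> (Suc n) a b = ((1 + s ^ 2) * count_prob \<rho> n (a - 1) (b - 1) + s ^ 2 * count_prob \<rho> n (a - 1) b
      + s ^ 4 * count_prob \<rho> n a (b - 1) + (s ^ 4 + s ^ 6) * count_prob \<rho> n a b) / Z"
    unfolding count_prob_Suc sum_mallows[of "\<lambda>u v. count_prob \<rho> n (a - of_bool u) (b - of_bool v)"] by simp
  also have "\<dots> = P ^ n * e * (s ^ 4 * (1 + s ^ 2) / Z * (w11 + w00) + s ^ 5 / Z * (w10 + w01))"
    unfolding Suc P_def[symmetric] e11 e10 e01 e_def[symmetric] w11_def[symmetric] w10_def[symmetric] w01_def[symmetric] w00_def[symmetric]
    by (simp add: algebra_simps add_divide_distrib eval_nat_numeral)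
  also have "\<dots> = P ^ Suc n * e * ((1 - x) / 2 * (w11 + w00) + x / 2 * (w10 + w01))"
    unfolding p0[symmetric] p1[symmetric] by (simp add: algebra_simps)
  finally show ?case
    by (simp only: walk_mix_Suc P_def e_def w11_def w10_def w01_def w00_def)
qed

text \<open>Counting down from the threshold \<open>m\<close> by \<open>a = m - i\<close>,
  \<open>b = m - j\<close> extracts the powers with exponent \<open>m\<close> and leaves weights
  that decay geometrically in \<open>i\<close> and \<open>j\<close>.\<close>

lemma prob_cw3_tilted:
  assumes n: "0 < n"
  shows "prob_cw3 \<rho> n = Ppoly \<rho> (zeta \<rho>) ^ n / ((s ^ 3) ^ ((n - 1) div 2) * s ^ ((n - 1) div 2)) *
     (\<Sum>i\<le>(n - 1) div 2. \<Sum>j\<le>(n - 1) div 2. (s ^ 3) ^ i * s ^ j *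
        walk_mix x n (int ((n - 1) div 2) - int i) (int ((n - 1) div 2) - int j))"
proof -
  let ?m = "(n - 1) div 2"
  have s: "s \<noteq> 0" using s_bounds by simp
  have rev: "(\<Sum>i\<le>m. f i) = (\<Sum>i\<le>m. f (m - i))" for m and f :: "nat \<Rightarrow> real"
    using sum.atLeastAtMost_rev[of f 0 m] by (simp add: atMost_atLeast0)
  have "prob_cw3 \<rho> n = (\<Sum>i\<le>?m. \<Sum>j\<le>?m. count_prob \<rho> n (int (?m - i)) (int (?m - j)))"
    unfolding prob_cw3_eq[OF n] by (subst rev, subst (2) rev) (rule refl)
  also have "\<dots> = (\<Sum>i\<le>?m. \<Sum>j\<le>?m. Ppoly \<rho> (zeta \<rho>) ^ n / ((s ^ 3) ^ ?m * s ^ ?m) *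
      ((s ^ 3) ^ i * s ^ j * walk_mix x n (int ?m - int i) (int ?m - int j)))"
  proof (intro sum.cong refl)
    fix i j assume "i \<in> {..?m}" "j \<in> {..?m}"
    then have ij: "int (?m - i) = int ?m - int i" "int (?m - j) = int ?m - int j" by (auto simp: of_nat_diff)
    have "s powi (- (3 * (int ?m - int i) + (int ?m - int j))) = s powi (int (3 * i + j) - int (3 * ?m + ?m))"
      by (simp add: algebra_simps)
    also have "\<dots> = s powi int (3 * i + j) / s powi int (3 * ?m + ?m)"
      using s by (intro power_int_diff) auto
    also have "\<dots> = (s ^ 3) ^ i * s ^ j / ((s ^ 3) ^ ?m * s ^ ?m)"
      by (simp only: power_int_of_nat power_add power_mult)
    finally show "count_prob \<rho> n (int (?m - i)) (int (?m - j)) = Ppoly \<rho> (zeta \<rho>) ^ n / ((s ^ 3) ^ ?m * s ^ ?m) *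
      ((s ^ 3) ^ i * s ^ j * walk_mix x n (int ?m - int i) (int ?m - int j))"
      unfolding count_prob_eq ij by simp
  qed
  finally show ?thesis by (simp only: sum_distrib_left)
qed

lemma det2_hessian_tau: "det2_hessian (Kfun \<rho>) (tau \<rho>) = 1 / 4 * (s * (1 + s ^ 2)) / (1 + s + s ^ 2) ^ 2"
proof -
  define a b c d where "a = (s ^ 4 + s ^ 6) / Z" and "b = s ^ 2 / Z" and "c = s ^ 4 / Z" and "d = (1 + s ^ 2) / Z"
  note abcd = a_def b_def c_def d_def
  have pos: "a > 0" "b > 0" "c > 0" "d > 0"
    using s_bounds Z_pos by (simp_all add: abcd add_pos_pos)
  have K: "Kfun \<rho> = (\<lambda>t. ln (a + b * exp (t 1) + c * exp (t 2) + d * (exp (t 1) * exp (t 2))))"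
    by (rule ext) (simp add: Kfun_def Ppoly_eq abcd add_divide_distrib distrib_right)
  have t: "s ^ 3 = exp (tau \<rho> 1)" "s = exp (tau \<rho> 2)"
    unfolding tau_def zeta_eq using s_bounds by simp_all
  have Z: "Z \<noteq> 0" using Z_pos by simp
  have S: "1 + s + s ^ 2 > 0" using s_bounds by (simp add: add_pos_pos)
  have s: "s > 0" using s_bounds by simp
  \<comment> \<open>All four linear factors at the tilt are multiples of \<open>S\<close>, and the
    minor is a multiple of \<open>S * T = 1 + s^2 + s^4\<close>, so the determinant reduces to
    \<open>S^2 - T^2\<close>.\<close>
  define S T where "S = 1 + s + s ^ 2" and "T = 1 - s + s ^ 2"
  have S0: "S > 0" using S by (simp add: S_def)
  have factors: "a + c * s = s ^ 4 * S / Z" "b + d * s = s * S / Z" "a + b * s ^ 3 = s ^ 4 * S / Z"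
    "c + d * s ^ 3 = s ^ 3 * S / Z"
    and denom: "a + b * s ^ 3 + c * s + d * (s ^ 3 * s) = 2 * s ^ 4 * S / Z"
    unfolding abcd S_def by (simp_all add: add_divide_distrib[symmetric]) (simp_all add: algebra_simps eval_nat_numeral)
  have "(s ^ 4 + s ^ 6) * (1 + s ^ 2) - s ^ 2 * s ^ 4 = s ^ 4 * (S * T)"
    by (simp add: S_def T_def algebra_simps eval_nat_numeral)
  then have minor: "a * d - b * c = s ^ 4 * (S * T) / Z ^ 2"
    by (simp add: abcd diff_divide_distrib[symmetric] power2_eq_square)
  have ST: "S ^ 2 - T ^ 2 = 4 * s * (1 + s ^ 2)"
    by (simp add: S_def T_def algebra_simps eval_nat_numeral)
  have "s ^ 3 * s * ((s ^ 4 * S / Z) * (s * S / Z) * (s ^ 4 * S / Z) * (s ^ 3 * S / Z) - s ^ 3 * s * (s ^ 4 * (S * T) / Z ^ 2)\<^sup>2)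
      = s ^ 16 * S ^ 2 * (S ^ 2 - T ^ 2) / Z ^ 4"
    using Z by (simp add: field_simps eval_nat_numeral)
  then have "det2_hessian (Kfun \<rho>) (tau \<rho>) = (s ^ 16 * S ^ 2 * (4 * s * (1 + s ^ 2)) / Z ^ 4) / (2 * s ^ 4 * S / Z) ^ 4"
    unfolding det2_hessian_ln_bilinear[OF pos K t] denom unfolding factors minor ST by (simp only:)
  also have "\<dots> = (s ^ 16 * S ^ 2 * (4 * s * (1 + s ^ 2))) / (16 * s ^ 16 * S ^ 4)"
    using Z by (simp add: power_divide power_mult_distrib)
  also have "\<dots> = 1 / 4 * (s * (1 + s ^ 2)) / S ^ 2"
    using s S0 by (simp add: field_simps)
  finally show ?thesis by (simp only: S_def)
qed

lemma prob_cw3_asymp_equiv: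
  "prob_cw3 \<rho> \<sim>[at_top] (\<lambda>n. Ppoly \<rho> (zeta \<rho>) ^ n /
      (\<Prod>j\<in>{1,2::nat}. (1 - zeta \<rho> j) * zeta \<rho> j ^ (nat \<lceil>real n / 2\<rceil> - 1))
      * (1 / (2 * pi * real n * sqrt (det2_hessian (Kfun \<rho>) (tau \<rho>)))))"
    (is "_ \<sim>[at_top] ?t")
proof -
  define q where "q = sqrt (x * (1 - x))"
  define R where "R n = (\<Sum>i\<le>(n - 1) div 2. \<Sum>j\<le>(n - 1) div 2. (s ^ 3) ^ i * s ^ j *
        walk_mix x n (int ((n - 1) div 2) - int i) (int ((n - 1) div 2) - int j))" for n
  have q: "q > 0" using x_bounds by (simp add: q_def)
  have s3: "0 \<le> s ^ 3" "s ^ 3 < 1" using s_bounds by (simp_all add: power_less_one_iff)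
  have S: "1 + s + s ^ 2 > 0" using s_bounds by (simp add: add_pos_pos)
  \<comment> \<open>Per voter the sum and the difference of the counts are uncorrelated with tilted
    variances \<open>1 - x\<close> and \<open>x\<close>; passing to them multiplies the covariance
    determinant by 4. Thus the claimed scale \<open>2 * pi * n * sqrt det\<close> is the walk scale
    \<open>pi * n * q\<close>.\<close>
  have "det2_hessian (Kfun \<rho>) (tau \<rho>) = x * (1 - x) / 4"
    unfolding det2_hessian_tau one_minus_x by (simp add: x_def power2_eq_square)
  then have det: "2 * sqrt (det2_hessian (Kfun \<rho>) (tau \<rho>)) = q"
    by (simp only: q_def real_sqrt_divide real_sqrt_four)
  have P: "Ppoly \<rho> (zeta \<rho>) > 0"
    unfolding Ppoly_zeta using s_bounds Z_pos S by simp
  have t: "?t n = Ppoly \<rho> (zeta \<rho>) ^ n / ((s ^ 3) ^ ((n - 1) div 2) * s ^ ((n - 1) div 2)) / ((1 - s ^ 3) * (1 - s) * (pi * real n * q))" for n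
    unfolding nat_ceiling_half det[symmetric] by (simp add: zeta_eq zeta_eq(1)[simplified] mult_ac)
  have "(\<lambda>n. real n * R n * ((1 - s ^ 3) * (1 - s) * (pi * q))) \<longlonglongrightarrow> 1 / (pi * q) / ((1 - s ^ 3) * (1 - s)) * ((1 - s ^ 3) * (1 - s) * (pi * q))"
    unfolding R_def q_def using s_bounds s3 x_bounds
    by (intro tendsto_mult_right geometric_walk_mix_sum_limit) auto
  moreover have "1 / (pi * q) / ((1 - s ^ 3) * (1 - s)) * ((1 - s ^ 3) * (1 - s) * (pi * q)) = 1"
    using s_bounds s3 q by simp
  ultimately have "(\<lambda>n. real n * R n * ((1 - s ^ 3) * (1 - s) * (pi * q))) \<longlonglongrightarrow> 1"
    by (simp only:)
  moreover have "\<forall>\<^sub>F n in sequentially. real n * R n * ((1 - s ^ 3) * (1 - s) * (pi * q)) = prob_cw3 \<rho> n / ?t n"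
    using eventually_gt_at_top[of 0]
  proof eventually_elim
    case (elim n)
    define c where "c = Ppoly \<rho> (zeta \<rho>) ^ n / ((s ^ 3) ^ ((n - 1) div 2) * s ^ ((n - 1) div 2))"
    have c: "c > 0" using P s_bounds by (simp add: c_def)
    have "prob_cw3 \<rho> n = c * R n"
      unfolding prob_cw3_tilted[OF elim] c_def R_def ..
    moreover have "?t n = c / ((1 - s ^ 3) * (1 - s) * (pi * real n * q))"
      unfolding t c_def ..
    ultimately show ?case
      using c by (simp only:) simp
  qed
  ultimately have "(\<lambda>n. prob_cw3 \<rho> n / ?t n) \<longlonglongrightarrow> 1"
    by (rule Lim_transform_eventually)
  then show ?thesis by (rule asymp_equivI')
qed

end

theorem theorem2:
  fixes \<rho> :: real
  assumes "\<rho> > 0"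
  shows "prob_cw3 \<rho> \<sim>[at_top]
           (\<lambda>n. Ppoly \<rho> (zeta \<rho>) ^ n /
              (\<Prod>j\<in>{1,2::nat}. (1 - zeta \<rho> j) * zeta \<rho> j ^ (nat \<lceil>real n / 2\<rceil> - 1))
              * (1 / (2 * pi * real n * sqrt (det2_hessian (Kfun \<rho>) (tau \<rho>)))))
       \<and> Ppoly \<rho> (zeta \<rho>) = 2 * exp (- 2 * \<rho>) * (1 + exp (- \<rho> / 2) + exp (- \<rho>))
              / ((1 + exp (- \<rho>)) * (1 + exp (- \<rho>) + exp (- 2 * \<rho>)))
       \<and> det2_hessian (Kfun \<rho>) (tau \<rho>) = 1 / 4 * (exp (- \<rho> / 2) * (1 + exp (- \<rho>)))
              / (1 + exp (- \<rho> / 2) + exp (- \<rho>)) ^ 2"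
proof -
  have e: "exp (- \<rho> / 2) ^ 2 = exp (- \<rho>)" "exp (- \<rho> / 2) ^ 4 = exp (- 2 * \<rho>)"
    by (simp_all add: exp_of_nat_mult[symmetric])
  show ?thesis
    using prob_cw3_asymp_equiv[OF assms] Ppoly_zeta[OF assms] det2_hessian_tau[OF assms]
    unfolding e by blast
qed

end
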